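(* Consider the smooth problem $\min_{y,z} f(y,z)$ subject to $\sum_{i=1}^b y_i=0$, and the asynchronous pairwise coordinate descent method (described in the context) with staleness bound $\tau$, started from a feasible point $x^0$. Let $\rho>1$ and let $\alpha_k=\alpha>0$ for all $k$, where $$\alpha<\frac{2}{1+\tau+\tau\rho^\tau}\qquad\text{and}\qquad \alpha<\frac{\rho-1}{\sqrt2\,(\tau+2)(\rho^{\tau+1}+\rho)}.$$ Let $\{x^k\}_{k\ge0}$ be the sequence generated with step size $\alpha_k$ and let $f^*$ be the optimal value. Then for every $k\ge1$, $$\mathbb{E}[f(x^k)]-f^*\le\frac{R^2(x^0)}{\mu k},\qquad \mu=\frac{\alpha^2}{2}\left(\frac1\alpha-\frac{1+\tau+\tau\rho^\tau}{2}\right),$$ where $$R(x^0)=\max_{x:\,f(x)\le f(x^0)}\ \max_{x^*\in X^*}\ \|x-x^*\|_{\mathcal K}^*.$$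
   Context: Problem. Variables are $y=(y_1,\dots,y_b)$, $z=(z_1,\dots,z_b)$ with $y_i\in\mathbb{R}^{n_y}$, $z_i\in\mathbb{R}^{n_z}$; write $x=(y,z)$, and let block $i$ be $x_i=(y_i,z_i)$. The function $f$ is convex and continuously differentiable. The problem is to minimize $f(y,z)$ subject to $\sum_{i=1}^b y_i=0$; $X^*$ denotes its (nonempty) set of optimal solutions and $f^*$ its optimal value. Block partial gradients are Lipschitz with a common constant $L>0$: for each $i$, $\|\nabla_i f(x+U_i h)-\nabla_i f(x)\|\le L\|h\|$ for all $x,h$, where $U_i$ embeds a block-$i$ vector into the full space; likewise, for each edge $(i,j)$, the partial gradient $\nabla_{ij}f$ with respect to $(x_i,x_j)$ is $L$-Lipschitz with respect to changes in the blocks $(x_i,x_j)$. Communication graph. $G=(V,E)$ is a connected graph on $V=\{1,\dots,b\}$; edge $(i,j)\in E$ is chosen with probability $p_{ij}=p_{ji}>0$, probabilities summing to $1$ over the (unordered) edges, and $p_{ij}=0$ for non-edges. Put $p_i=\sum_{j\ne i}p_{ij}$. Asynchronous algorithm (consistent reading model). Start from a feasible $x^0$. At iteration $k\ge0$ an edge $(i_k,j_k)\in E$ is drawn independently of the past with probability $p_{i_kj_k}$, and the gradients are evaluated at an earlier iterate $x^{D(k)}$, where $(D(k))_{k\ge 0}$ is a given sequence of indices with $0\le D(k)\le k$ and $k-D(k)\le\tau$ ($\tau\ge0$ an integer). Then $x^{k+1}$ is obtained from $x^k$ by incrementing blocks $i_k,j_k$ as follows: $y_{i_k}$ by $\frac{\alpha_k}{2L}(\nabla_{y_{j_k}}f(x^{D(k)})-\nabla_{y_{i_k}}f(x^{D(k)}))$,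 $y_{j_k}$ by the negative of this, $z_{i_k}$ by $-\frac{\alpha_k}{L}\nabla_{z_{i_k}}f(x^{D(k)})$, and $z_{j_k}$ by $-\frac{\alpha_k}{L}\nabla_{z_{j_k}}f(x^{D(k)})$. The expectation is over the random edges. Norms. Let $\mathcal L,\mathcal D\in\mathbb{R}^{b\times b}$ be given by $\mathcal L_{ii}=\sum_{r\ne i}\frac{p_{ir}}{2L}$, $\mathcal L_{ij}=-\frac{p_{ij}}{2L}$ for $i\ne j$, $\mathcal D=\mathrm{diag}(p_1/L,\dots,p_b/L)$. Let $\mathcal K$ be the block diagonal matrix with blocks $\mathcal L\otimes I_{n_y}$ (acting on $y$) and $\mathcal D\otimes I_{n_z}$ (acting on $z$), and $$\|x\|_{\mathcal K}^*=\sqrt{y^\top(\mathcal L^+\otimes I_{n_y})y+z^\top(\mathcal D^{-1}\otimes I_{n_z})z},$$ where $\mathcal L^+$ is the Moore–Penrose pseudoinverse. The maxima defining $R(x^0)$ are assumed to exist. *)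

theory Defs
  imports "HOL-Probability.Probability"
begin

text \<open>
  The blocks are indexed by a finite type \<open>'v\<close>, and a point is a vector
  \<open>x :: ('y \<times> 'z) ^ 'v\<close> whose block \<open>x $ i\<close> is the pair \<open>(y\<^sub>i, z\<^sub>i)\<close>.  Its norm is the Euclidean norm of
  the concatenated vector, the block gradient is \<open>g x $ i\<close> when \<open>g\<close> is the gradient of \<open>f\<close>, and the
  embedding of the \<open>i\<close>-th block is \<open>axis i\<close>.
\<close>

type_synonym ('y, 'z, 'v) point = "('y \<times> 'z) ^ 'v"

definition feasible :: "('y::real_inner, 'z::real_inner, 'v::finite) point set" where
  "feasible = {x. (\<Sum>i\<in>UNIV. fst (x $ i)) = 0}"

definition optimal_set :: "(('y::real_inner, 'z::real_inner, 'v::finite) point \<Rightarrow> real)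
    \<Rightarrow> ('y, 'z, 'v) point set" where
  "optimal_set f = {x \<in> feasible. \<forall>x'\<in>feasible. f x \<le> f x'}"

definition optimal_value :: "(('y::real_inner, 'z::real_inner, 'v::finite) point \<Rightarrow> real) \<Rightarrow> real" where
  "optimal_value f = (INF x\<in>feasible. f x)"

text \<open>
  One step on the edge \<open>(i, j)\<close>: \<open>r\<close> is the gradient at the point that was read, \<open>x\<close> the iterate that is
  incremented.  The result is symmetric in \<open>i\<close> and \<open>j\<close>, so it depends only on the unordered edge.
\<close>

definition pair_update :: "real \<Rightarrow> real \<Rightarrow> ('y::real_inner, 'z::real_inner, 'v::finite) point
    \<Rightarrow> 'v \<Rightarrow> 'v \<Rightarrow> ('y, 'z, 'v) point \<Rightarrow> ('y, 'z, 'v) point" where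
  "pair_update L a r i j x =
     (let d = (a / (2 * L)) *\<^sub>R (fst (r $ j) - fst (r $ i))
      in x + axis i (d, - ((a / L) *\<^sub>R snd (r $ i)))
           + axis j (- d, - ((a / L) *\<^sub>R snd (r $ j))))"

definition laplacian_matrix :: "real \<Rightarrow> ('v::finite \<Rightarrow> 'v \<Rightarrow> real) \<Rightarrow> real ^ 'v ^ 'v" where
  "laplacian_matrix L p =
     (\<chi> i j. if i = j then (\<Sum>r\<in>UNIV - {i}. p i r / (2 * L)) else - p i j / (2 * L))"

definition degree_matrix :: "real \<Rightarrow> ('v::finite \<Rightarrow> 'v \<Rightarrow> real) \<Rightarrow> real ^ 'v ^ 'v" where
  "degree_matrix L p = (\<chi> i j. if i = j then (\<Sum>r\<in>UNIV - {i}. p i r) / L else 0)"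

text \<open>The four Penrose conditions, which determine the pseudoinverse uniquely.\<close>

definition is_moore_penrose :: "real ^ 'n ^ 'm \<Rightarrow> real ^ 'm ^ 'n \<Rightarrow> bool" where
  "is_moore_penrose A B \<longleftrightarrow>
     A ** B ** A = A \<and> B ** A ** B = B \<and>
     transpose (A ** B) = A ** B \<and> transpose (B ** A) = B ** A"

definition moore_penrose :: "real ^ 'n ^ 'm \<Rightarrow> real ^ 'm ^ 'n" where
  "moore_penrose A = (THE B. is_moore_penrose A B)"

text \<open>\<open>kron_form A v\<close> is the quadratic form \<open>v\<^sup>T (A \<otimes> I) v\<close> of a block vector \<open>v\<close>.\<close>

definition kron_form :: "real ^ 'v ^ 'v \<Rightarrow> ('v::finite \<Rightarrow> 'a::real_inner) \<Rightarrow> real" where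
  "kron_form A v = (\<Sum>i\<in>UNIV. \<Sum>j\<in>UNIV. A $ i $ j * (v i \<bullet> v j))"

definition dual_norm_K :: "real \<Rightarrow> ('v::finite \<Rightarrow> 'v \<Rightarrow> real)
    \<Rightarrow> ('y::real_inner, 'z::real_inner, 'v) point \<Rightarrow> real" where
  "dual_norm_K L p x =
     sqrt (kron_form (moore_penrose (laplacian_matrix L p)) (\<lambda>i. fst (x $ i))
         + kron_form (matrix_inv (degree_matrix L p)) (\<lambda>i. snd (x $ i)))"

definition has_maximum :: "real set \<Rightarrow> bool" where
  "has_maximum S \<longleftrightarrow> (\<exists>m\<in>S. \<forall>s\<in>S. s \<le> m)"

definition maximum :: "real set \<Rightarrow> real" where
  "maximum S = (GREATEST m. m \<in> S)"

text \<open>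
  The radius is \<open>R(x\<^sub>0) = max\<^bsub>x\<^esub> max\<^bsub>x*\<^esub> \<parallel>x - x*\<parallel>\<close>.  The outer maximum is over the whole sublevel set, with no
  feasibility condition on \<open>x\<close>.
\<close>

definition sublevel :: "(('y::real_inner, 'z::real_inner, 'v::finite) point \<Rightarrow> real)
    \<Rightarrow> ('y, 'z, 'v) point \<Rightarrow> ('y, 'z, 'v) point set" where
  "sublevel f x0 = {x. f x \<le> f x0}"

definition distances_to_opt :: "(('y::real_inner, 'z::real_inner, 'v::finite) point \<Rightarrow> real)
    \<Rightarrow> real \<Rightarrow> ('v \<Rightarrow> 'v \<Rightarrow> real) \<Rightarrow> ('y, 'z, 'v) point \<Rightarrow> real set" where
  "distances_to_opt f L p x = (\<lambda>xs. dual_norm_K L p (x - xs)) ` optimal_set f"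

definition max_distances :: "(('y::real_inner, 'z::real_inner, 'v::finite) point \<Rightarrow> real)
    \<Rightarrow> real \<Rightarrow> ('v \<Rightarrow> 'v \<Rightarrow> real) \<Rightarrow> ('y, 'z, 'v) point \<Rightarrow> real set" where
  "max_distances f L p x0 = (\<lambda>x. maximum (distances_to_opt f L p x)) ` sublevel f x0"

definition radius :: "(('y::real_inner, 'z::real_inner, 'v::finite) point \<Rightarrow> real)
    \<Rightarrow> real \<Rightarrow> ('v \<Rightarrow> 'v \<Rightarrow> real) \<Rightarrow> ('y, 'z, 'v) point \<Rightarrow> real" where
  "radius f L p x0 = maximum (max_distances f L p x0)"

text \<open>
  In the theorem, \<open>\<real>\<^sup>n\<close> is rendered by the sort \<open>{real_inner, heine_borel}\<close>, the finite-dimensional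
  real inner product spaces.  Unlike \<open>euclidean_space\<close> it also admits dimension 0, that is, problems
  without \<open>y\<close> or without \<open>z\<close> variables.  The edge relation \<open>E\<close> is symmetric, so it contains every
  unordered edge twice and the probabilities sum to 2 over it.
\<close>

end

theory Submission
  imports Defs
begin

text \<open>
  A step on the edge \<open>(i, j)\<close> is \<open>- (\<alpha> / L) P\<^sub>i\<^sub>j r\<close>, where \<open>P\<^sub>i\<^sub>j\<close> is the orthogonal projection onto the
  feasible directions supported on \<open>i\<close> and \<open>j\<close> and \<open>r\<close> is the gradient that was read.  For convex \<open>f\<close> the
  Lipschitz condition on single edges implies that a step on one edge changes the partial gradient along
  any other edge by at most \<open>L\<close> times its length, which controls the error made by stale gradients.

  With \<open>s\<^sub>k\<close> the length of step \<open>k\<close> this gives, on every run,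
  \<open>f (x\<^sub>k\<^sub>+\<^sub>1) \<le> f (x\<^sub>k) - L (1/\<alpha> - (1 + \<tau>)/2) s\<^sub>k\<^sup>2 + (L/2) \<Sum> s\<^sub>t\<^sup>2\<close>, the sum being over the last \<open>\<tau>\<close> steps.
  Summed over \<open>k\<close>, it shows that no run leaves the sublevel set of \<open>x\<^sub>0\<close>, so the radius bounds all
  distances that occur.  In expectation, the second step size condition yields \<open>E s\<^sub>k\<^sup>2 \<le> \<rho> E s\<^sub>k\<^sub>+\<^sub>1\<^sup>2\<close>, so the
  sum is absorbed.  Since \<open>E s\<^sub>k\<^sup>2\<close> is \<open>\<alpha>\<^sup>2/L\<close> times the expected squared \<open>K\<close>-norm of the gradient that was
  read, the expected gap satisfies \<open>\<delta>\<^sub>k\<^sub>+\<^sub>1 \<le> \<delta>\<^sub>k - 2 \<mu> \<delta>\<^sub>k\<^sup>2 / R\<^sup>2\<close>, which gives the rate.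
\<close>

section \<open>Convex functions with Lipschitz partial gradients\<close>

text \<open>For positive \<open>c\<close>, evaluate at the minimizer \<open>b / c\<close>; for
  \<open>c = 0\<close> an affine function is bounded below only if its slope vanishes. Used in
  \<open>cross_lipschitz\<close> and for Cauchy-Schwarz on the semidefinite
  \<open>edge_form\<close>.\<close>

lemma discriminant_le:
  fixes a b c :: real
  assumes "\<And>s. 0 \<le> a - 2 * b * s + c * s\<^sup>2" and "0 \<le> c"
  shows "b\<^sup>2 \<le> a * c"
proof (cases "c = 0")
  case True
  have "b = 0"
  proof (rule ccontr)
    assume "b \<noteq> 0"
    \<comment> \<open>At this witness the affine function takes the value -1.\<close>
    with assms(1)[of "(a + 1) / (2 * b)"] True show False
      by (simp add: field_simps)
  qed
  with True show ?thesis by simp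
next
  case False
  with assms have "c > 0" by simp
  with assms(1)[of "b / c"] show ?thesis
    by (simp add: field_simps power2_eq_square)
qed

lemma GDERIV_line:
  fixes f :: "'a::real_inner \<Rightarrow> real"
  assumes "\<And>u. GDERIV f u :> g u"
  shows "((\<lambda>t. f (u + t *\<^sub>R d)) has_field_derivative g (u + t *\<^sub>R d) \<bullet> d) (at t)"
proof -
  have "(f has_derivative (\<lambda>h. h \<bullet> g (u + t *\<^sub>R d))) (at (u + t *\<^sub>R d))"
    using assms by (simp add: gderiv_def)
  moreover have "((\<lambda>t. u + t *\<^sub>R d) has_derivative (\<lambda>h. h *\<^sub>R d)) (at t)"
    by (auto intro!: derivative_eq_intros)
  ultimately have "((\<lambda>t. f (u + t *\<^sub>R d)) has_derivative (\<lambda>h. (h *\<^sub>R d) \<bullet> g (u + t *\<^sub>R d))) (at t)"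
    by (rule has_derivative_compose[rotated])
  then show ?thesis
    by (simp add: has_field_derivative_def inner_commute mult_commute_abs)
qed

text \<open>Restriction to the line through \<open>u\<close> and \<open>v\<close> reduces this to
  the tangent inequality for convex functions of one variable.\<close>

lemma convex_gradient_le:
  fixes f :: "'a::real_inner \<Rightarrow> real"
  assumes f: "convex_on UNIV f" and g: "\<And>u. GDERIV f u :> g u"
  shows "f u + g u \<bullet> (v - u) \<le> f v"
proof -
  let ?\<phi> = "\<lambda>t::real. f (u + t *\<^sub>R (v - u))"
  have "convex_on UNIV ?\<phi>"
  proof (intro convex_onI)
    fix t a b :: real
    assume t: "0 < t" "t < 1"
    have "u + ((1 - t) *\<^sub>R a + t *\<^sub>R b) *\<^sub>R (v - u)
        = (1 - t) *\<^sub>R (u + a *\<^sub>R (v - u)) + t *\<^sub>R (u + b *\<^sub>R (v - u))"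
      by (simp add: algebra_simps)
    then show "?\<phi> ((1 - t) *\<^sub>R a + t *\<^sub>R b) \<le> (1 - t) * ?\<phi> a + t * ?\<phi> b"
      using convex_onD[OF f, of t "u + a *\<^sub>R (v - u)" "u + b *\<^sub>R (v - u)"] t by simp
  qed simp
  from convex_on_imp_above_tangent[OF this, of 0 1 "g u \<bullet> (v - u)"] GDERIV_line[OF g, of u "v - u" 0]
  show ?thesis by simp
qed

lemma descent_along:
  fixes f :: "'a::real_inner \<Rightarrow> real"
  assumes g: "\<And>u. GDERIV f u :> g u"
    and lip: "\<And>t. 0 \<le> t \<Longrightarrow> (g (u + t *\<^sub>R d) - g u) \<bullet> d \<le> L * t * (norm d)\<^sup>2"
  shows "f (u + d) \<le> f u + g u \<bullet> d + L / 2 * (norm d)\<^sup>2"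
proof -
  \<comment> \<open>\<open>f\<close> along the ray minus the linear and quadratic terms of the
    claimed bound; by \<open>lip\<close> its derivative is nonpositive.\<close>
  let ?\<psi> = "\<lambda>t. f (u + t *\<^sub>R d) - t * (g u \<bullet> d) - t\<^sup>2 * (L / 2 * (norm d)\<^sup>2)"
  have "?\<psi> 1 \<le> ?\<psi> 0"
  proof (rule DERIV_nonpos_imp_nonincreasing[where f = ?\<psi>])
    fix t :: real
    assume "0 \<le> t"
    have "(?\<psi> has_field_derivative
        g (u + t *\<^sub>R d) \<bullet> d - g u \<bullet> d - 2 * t * (L / 2 * (norm d)\<^sup>2)) (at t)"
      by (auto intro!: derivative_eq_intros GDERIV_line[OF g])
    moreover have "g (u + t *\<^sub>R d) \<bullet> d - g u \<bullet> d - 2 * t * (L / 2 * (norm d)\<^sup>2) \<le> 0"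
      using lip[OF \<open>0 \<le> t\<close>] by (simp add: inner_diff_left mult_ac)
    ultimately show "\<exists>y. (?\<psi> has_field_derivative y) (at t) \<and> y \<le> 0"
      by blast
  qed simp
  then show ?thesis by simp
qed

text \<open>
  Descent along \<open>d\<close> and along \<open>d'\<close> bounds the variation of the gradient in direction \<open>d\<close> caused by a
  move in direction \<open>d'\<close>: the Bregman divergence from \<open>u\<close> is nonnegative on the whole line
  \<open>u + d' - s d\<close>, so the quadratic upper bound along that line has a nonpositive discriminant.
\<close>

lemma cross_lipschitz:
  fixes f :: "'a::real_inner \<Rightarrow> real"
  assumes f: "convex_on UNIV f" and g: "\<And>u. GDERIV f u :> g u" and L: "0 \<le> L"
    and d': "f (u + d') \<le> f u + g u \<bullet> d' + L / 2 * (norm d')\<^sup>2"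
    and d: "\<And>s. f (u + d' + s *\<^sub>R d)
                \<le> f (u + d') + g (u + d') \<bullet> (s *\<^sub>R d) + L / 2 * (norm (s *\<^sub>R d))\<^sup>2"
  shows "(g (u + d') - g u) \<bullet> d \<le> L * norm d' * norm d"
proof -
  let ?c = "(g (u + d') - g u) \<bullet> d"
  have "0 \<le> L * (norm d')\<^sup>2 - 2 * ?c * s + L * (norm d)\<^sup>2 * s\<^sup>2" for s
  proof -
    have "f u + g u \<bullet> (d' - s *\<^sub>R d) \<le> f (u + d' - s *\<^sub>R d)"
      using convex_gradient_le[OF f g, of u "u + d' - s *\<^sub>R d"] by (simp add: algebra_simps)
    also have "\<dots> \<le> f u + g u \<bullet> d' + L / 2 * (norm d')\<^sup>2 - s * (g (u + d') \<bullet> d)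
        + L / 2 * (s\<^sup>2 * (norm d)\<^sup>2)"
      using d[of "- s"] d' by (simp add: power_mult_distrib)
    finally show ?thesis
      by (simp add: algebra_simps inner_diff_left inner_diff_right)
  qed
  then have "?c\<^sup>2 \<le> L * (norm d')\<^sup>2 * (L * (norm d)\<^sup>2)"
    using L by (intro discriminant_le) auto
  also have "\<dots> = (L * norm d' * norm d)\<^sup>2"
    by (simp add: power2_eq_square)
  finally show ?thesis
    using L by (meson mult_nonneg_nonneg norm_ge_zero power2_le_imp_le)
qed

section \<open>The projection onto the feasible directions of an edge\<close>

text \<open>The two \<open>y\<close> parts need not cancel. The space contains the range of
  \<open>pair_proj\<close>, and the Lipschitz condition on an edge covers all of it.\<close>

definition edge_space :: "'v \<Rightarrow> 'v \<Rightarrow> ('y::real_inner, 'z::real_inner, 'v::finite) point set" where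
  "edge_space i j = {axis i h + axis j h' | h h'. True}"

definition pair_proj :: "'v \<Rightarrow> 'v \<Rightarrow> ('y::real_inner, 'z::real_inner, 'v::finite) point
    \<Rightarrow> ('y, 'z, 'v) point" where
  "pair_proj i j r = axis i ((1 / 2) *\<^sub>R (fst (r $ i) - fst (r $ j)), snd (r $ i))
                   + axis j ((1 / 2) *\<^sub>R (fst (r $ j) - fst (r $ i)), snd (r $ j))"

lemma pair_proj_commute: "pair_proj i j r = pair_proj j i r"
  by (simp add: pair_proj_def add.commute)

lemma pair_proj_in_edge_space: "pair_proj i j r \<in> edge_space i j"
  unfolding edge_space_def pair_proj_def by blast

lemma scaleR_in_edge_space: "d \<in> edge_space i j \<Longrightarrow> c *\<^sub>R d \<in> edge_space i j"
proof -
  have "c *\<^sub>R (axis i h + axis j h') = axis i (c *\<^sub>R h) + axis j (c *\<^sub>R h')"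
    for h h' :: "'a \<times> 'b"
    by (simp add: vec_eq_iff axis_def scaleR_add_right)
  then show "d \<in> edge_space i j \<Longrightarrow> c *\<^sub>R d \<in> edge_space i j"
    unfolding edge_space_def by blast
qed

lemma linear_pair_proj: "linear (pair_proj i j)"
  by (rule linearI) (auto simp: pair_proj_def vec_eq_iff axis_def algebra_simps)

lemma pair_update_eq: "pair_update L a r i j x = x - (a / L) *\<^sub>R pair_proj i j r"
  by (auto simp: pair_update_def pair_proj_def Let_def vec_eq_iff axis_def prod_eq_iff algebra_simps)

lemma inner_pair_proj:
  "w \<bullet> pair_proj i j r
     = (1 / 2) * ((fst (w $ i) - fst (w $ j)) \<bullet> (fst (r $ i) - fst (r $ j)))
       + snd (w $ i) \<bullet> snd (r $ i) + snd (w $ j) \<bullet> snd (r $ j)"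
  by (simp add: pair_proj_def inner_add_right inner_axis inner_prod_def inner_diff_right
      inner_diff_left algebra_simps)

text \<open>Self-adjointness and idempotence of the projection in one identity. For
  \<open>i = j\<close> both axis terms would fall on the same block and double the \<open>z\<close>
  part.\<close>

lemma inner_pair_proj_self:
  assumes "i \<noteq> j"
  shows "pair_proj i j w \<bullet> pair_proj i j r = w \<bullet> pair_proj i j r"
proof -
  have nth: "pair_proj i j w $ i = ((1 / 2) *\<^sub>R (fst (w $ i) - fst (w $ j)), snd (w $ i))"
    "pair_proj i j w $ j = ((1 / 2) *\<^sub>R (fst (w $ j) - fst (w $ i)), snd (w $ j))"
    using assms by (auto simp: pair_proj_def axis_def)
  have "(1 / 2) *\<^sub>R (fst (w $ i) - fst (w $ j)) - (1 / 2) *\<^sub>R (fst (w $ j) - fst (w $ i))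
      = fst (w $ i) - fst (w $ j)"
    by (simp add: algebra_simps flip: scaleR_add_left)
  then show ?thesis
    by (simp add: inner_pair_proj nth)
qed

lemma norm_pair_proj: "i \<noteq> j \<Longrightarrow> (norm (pair_proj i j r))\<^sup>2 = r \<bullet> pair_proj i j r"
  by (simp add: power2_norm_eq_inner inner_pair_proj_self)

lemma sum_fst_pair_proj:
  fixes r :: "('y::real_inner, 'z::real_inner, 'v::finite) point"
  shows "(\<Sum>v\<in>UNIV. fst (pair_proj i j r $ v)) = 0"
proof -
  have sum_axis: "(\<Sum>v\<in>UNIV. fst (axis k h $ v)) = fst h" for k :: 'v and h :: "'y \<times> 'z"
    by (simp add: axis_def if_distrib[of fst] cong: if_cong)
  show ?thesis
    by (simp add: pair_proj_def sum.distrib sum_axis flip: scaleR_add_right)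
qed

section \<open>The Laplacian and its dual norm\<close>

lemma matrix_add_rdistrib: "(A + B) ** C = A ** C + B ** C" for C :: "real ^ 'n ^ 'm"
  by (simp add: matrix_matrix_mult_def vec_eq_iff sum.distrib distrib_right)

lemma matrix_diff_ldistrib: "A ** (B - C) = A ** B - A ** C" for C :: "real ^ 'n ^ 'm"
  by (simp add: matrix_matrix_mult_def vec_eq_iff sum_subtractf right_diff_distrib)

lemma matrix_diff_rdistrib: "(A - B) ** C = A ** C - B ** C" for C :: "real ^ 'n ^ 'm"
  by (simp add: matrix_matrix_mult_def vec_eq_iff sum_subtractf left_diff_distrib)

text \<open>Since \<open>A ** C ** A = A\<close>, the product of \<open>A ** C\<close> and
  \<open>A ** B\<close> is \<open>A ** B\<close>; transposing it, with both factors symmetric, gives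
  \<open>A ** C\<close>. So these agree, likewise \<open>B ** A\<close> and \<open>C ** A\<close>,
  and then B = BAB = CAB = CAC = C.\<close>

lemma moore_penrose_unique:
  fixes A :: "real ^ 'n ^ 'm"
  assumes B: "is_moore_penrose A B" and C: "is_moore_penrose A C"
  shows "B = C"
proof -
  have aba: "A ** B ** A = A" "B ** A ** B = B" "transpose (A ** B) = A ** B" "transpose (B ** A) = B ** A"
    using B unfolding is_moore_penrose_def by blast+
  have aca: "A ** C ** A = A" "C ** A ** C = C" "transpose (A ** C) = A ** C" "transpose (C ** A) = C ** A"
    using C unfolding is_moore_penrose_def by blast+
  have "A ** B = transpose ((A ** C) ** (A ** B))"
    unfolding matrix_mul_assoc aca(1) by (simp only: aba(3))
  also have "\<dots> = (A ** B) ** (A ** C)"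
    unfolding matrix_transpose_mul[of "A ** C" "A ** B"] aba(3) aca(3) ..
  also have "\<dots> = A ** C"
    unfolding matrix_mul_assoc aba(1) ..
  finally have AB: "A ** B = A ** C" .
  have "B ** A = transpose ((B ** A) ** (C ** A))"
    by (simp only: matrix_mul_assoc[symmetric] aca(1)[folded matrix_mul_assoc] aba(4)[folded matrix_mul_assoc] aba(4))
  also have "\<dots> = (C ** A) ** (B ** A)"
    unfolding matrix_transpose_mul[of "B ** A" "C ** A"] aba(4) aca(4) ..
  also have "\<dots> = C ** A"
    by (simp only: matrix_mul_assoc[symmetric] aba(1)[folded matrix_mul_assoc])
  finally have BA: "B ** A = C ** A" .
  have "B = C ** A ** B"
    using aba(2) by (simp only: BA)
  also have "\<dots> = C ** (A ** C)"
    by (simp only: matrix_mul_assoc[symmetric] AB)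
  finally show ?thesis
    using aca(2) by (simp only: matrix_mul_assoc)
qed

lemma moore_penrose_eq: "is_moore_penrose A B \<Longrightarrow> moore_penrose A = B"
  unfolding moore_penrose_def using moore_penrose_unique by blast

lemma matrix_inv_eq:
  fixes A B :: "real ^ 'n ^ 'n"
  assumes "A ** B = mat 1" "B ** A = mat 1"
  shows "matrix_inv A = B"
proof -
  have "A ** matrix_inv A = mat 1 \<and> matrix_inv A ** A = mat 1"
    unfolding matrix_inv_def by (rule someI[where x = B]) (simp add: assms)
  then have "B ** (A ** matrix_inv A) = B"
    by simp
  then show ?thesis
    by (simp add: matrix_mul_assoc assms(2))
qed

section \<open>The weighted graph, its Laplacian and the norms it defines\<close>

locale edge_graph =
  fixes E :: "('v::finite \<times> 'v) set" and p :: "'v \<Rightarrow> 'v \<Rightarrow> real" and L :: real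
  assumes E_irrefl: "irrefl E"
    and E_connected: "\<And>i j. (i, j) \<in> E\<^sup>*"
    and p_sym: "\<And>i j. p i j = p j i"
    and p_edge: "\<And>i j. (i, j) \<in> E \<Longrightarrow> p i j > 0"
    and p_nonedge: "\<And>i j. (i, j) \<notin> E \<Longrightarrow> p i j = 0"
    and p_sum: "(\<Sum>(i, j)\<in>E. p i j) = 2"
    and L_pos: "L > 0"
begin

lemma edge_neq: "(i, j) \<in> E \<Longrightarrow> i \<noteq> j"
  using E_irrefl by (auto simp: irrefl_def)

lemma p_nonneg: "0 \<le> p i j"
  using p_edge p_nonedge by (cases "(i, j) \<in> E") (auto intro: less_imp_le)

lemma p_self: "p i i = 0"
  using p_nonedge[of i i] edge_neq[of i i] by auto

definition degree :: "'v \<Rightarrow> real" where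
  "degree i = (\<Sum>j\<in>UNIV. p i j)"

text \<open>The total weight 2 forces an edge, hence a second vertex, and connectedness then gives
  every vertex a neighbour. This makes \<open>degree_matrix L p\<close> invertible.\<close>

lemma degree_pos: "degree i > 0"
proof -
  obtain a b where "(a, b) \<in> E"
    using p_sum by (cases "E = {}") auto
  then have "a \<noteq> b"
    by (rule edge_neq)
  then obtain c where "c \<noteq> i"
    by (cases "a = i") (auto dest: not_sym)
  then obtain j where "(i, j) \<in> E"
    using E_connected[of i c] by (metis converse_rtranclE)
  then have "0 < p i j"
    by (rule p_edge)
  also have "\<dots> \<le> degree i"
    unfolding degree_def by (rule member_le_sum) (auto simp: p_nonneg)
  finally show ?thesis .
qed

lemma sum_edges: "(\<Sum>(i, j)\<in>E. p i j * F i j) = (\<Sum>i\<in>UNIV. \<Sum>j\<in>UNIV. p i j * F i j)"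
proof -
  have "(\<Sum>(i, j)\<in>E. p i j * F i j) = (\<Sum>(i, j)\<in>UNIV. p i j * F i j)"
    by (rule sum.mono_neutral_left) (auto simp: p_nonedge)
  then show ?thesis
    by (simp add: sum.cartesian_product)
qed

lemma off_diagonal_sum: "(\<Sum>j\<in>UNIV - {i}. p i j) = degree i"
  unfolding degree_def by (rule sum.mono_neutral_left) (auto simp: p_self)

lemma laplacian_nth:
  "laplacian_matrix L p $ i $ j = ((if i = j then degree i else 0) - p i j) / (2 * L)"
  by (simp add: laplacian_matrix_def off_diagonal_sum p_self flip: sum_divide_distrib)

lemma laplacian_sum:
  fixes w :: "'v \<Rightarrow> 'a::real_vector"
  shows "(\<Sum>j\<in>UNIV. laplacian_matrix L p $ i $ j *\<^sub>R w j)
           = (1 / (2 * L)) *\<^sub>R (degree i *\<^sub>R w i - (\<Sum>j\<in>UNIV. p i j *\<^sub>R w j))"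
proof -
  have "laplacian_matrix L p $ i $ j *\<^sub>R w j
      = (1 / (2 * L)) *\<^sub>R ((if i = j then degree i *\<^sub>R w i else 0) - p i j *\<^sub>R w j)" for j
    by (simp add: laplacian_nth scaleR_diff_right diff_divide_distrib scaleR_diff_left)
  then show ?thesis
    by (simp add: sum_subtractf flip: scaleR_sum_right)
qed

text \<open>The Dirichlet form of the graph. The factor \<open>4 * L\<close> is 2, from counting
  ordered pairs, times \<open>2 * L\<close>, which undoes the scaling of the Laplacian.\<close>

lemma laplacian_form:
  fixes u w :: "'v \<Rightarrow> 'a::real_inner"
  shows "(\<Sum>i\<in>UNIV. \<Sum>j\<in>UNIV. p i j * ((u i - u j) \<bullet> (w i - w j)))
           = 4 * L * (\<Sum>i\<in>UNIV. u i \<bullet> (\<Sum>j\<in>UNIV. laplacian_matrix L p $ i $ j *\<^sub>R w j))"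
proof -
  have "(\<Sum>i\<in>UNIV. \<Sum>j\<in>UNIV. p i j * ((u i - u j) \<bullet> (w i - w j)))
      = (\<Sum>i\<in>UNIV. \<Sum>j\<in>UNIV. p i j * (u i \<bullet> w i)) + (\<Sum>i\<in>UNIV. \<Sum>j\<in>UNIV. p i j * (u j \<bullet> w j))
        - (\<Sum>i\<in>UNIV. \<Sum>j\<in>UNIV. p i j * (u i \<bullet> w j)) - (\<Sum>i\<in>UNIV. \<Sum>j\<in>UNIV. p i j * (u j \<bullet> w i))"
    by (simp add: inner_diff_left inner_diff_right algebra_simps sum.distrib sum_subtractf)
  also have "(\<Sum>i\<in>UNIV. \<Sum>j\<in>UNIV. p i j * (u j \<bullet> w j)) = (\<Sum>i\<in>UNIV. \<Sum>j\<in>UNIV. p i j * (u i \<bullet> w i))"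
    by (subst sum.swap) (simp add: p_sym)
  also have "(\<Sum>i\<in>UNIV. \<Sum>j\<in>UNIV. p i j * (u j \<bullet> w i)) = (\<Sum>i\<in>UNIV. \<Sum>j\<in>UNIV. p i j * (u i \<bullet> w j))"
    by (subst sum.swap) (simp add: p_sym)
  also have "(\<Sum>i\<in>UNIV. \<Sum>j\<in>UNIV. p i j * (u i \<bullet> w i)) = (\<Sum>i\<in>UNIV. degree i * (u i \<bullet> w i))"
    by (simp add: degree_def sum_distrib_right)
  also have "(\<Sum>i\<in>UNIV. degree i * (u i \<bullet> w i)) + (\<Sum>i\<in>UNIV. degree i * (u i \<bullet> w i))
        - (\<Sum>i\<in>UNIV. \<Sum>j\<in>UNIV. p i j * (u i \<bullet> w j)) - (\<Sum>i\<in>UNIV. \<Sum>j\<in>UNIV. p i j * (u i \<bullet> w j))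
      = (\<Sum>i\<in>UNIV. 2 * (degree i * (u i \<bullet> w i) - (\<Sum>j\<in>UNIV. p i j * (u i \<bullet> w j))))"
    by (simp add: sum_subtractf flip: sum_distrib_left)
  also have "\<dots> = 4 * L * (\<Sum>i\<in>UNIV. u i \<bullet> (\<Sum>j\<in>UNIV. laplacian_matrix L p $ i $ j *\<^sub>R w j))"
    unfolding sum_distrib_left laplacian_sum using L_pos
    by (intro sum.cong refl) (simp add: inner_diff_right inner_sum_right)
  finally show ?thesis .
qed

text \<open>The Dirichlet form of \<open>w\<close> vanishes, so \<open>w\<close> is constant along
  each edge, and connectedness spreads this to all vertices.\<close>

lemma laplacian_kernel:
  fixes w :: "'v \<Rightarrow> real"
  assumes "\<And>i. (\<Sum>j\<in>UNIV. laplacian_matrix L p $ i $ j * w j) = 0"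
  shows "w i = w j"
proof -
  have "(\<Sum>(i, j)\<in>E. p i j * (w i - w j)\<^sup>2) = 0"
    using assms laplacian_form[of w w] by (simp add: sum_edges power2_eq_square)
  then have "\<forall>(i, j)\<in>E. p i j * (w i - w j)\<^sup>2 = 0"
    by (subst (asm) sum_nonneg_eq_0_iff) (auto simp: p_nonneg)
  then have edge: "w i = w j" if "(i, j) \<in> E" for i j
    using p_edge[OF that] that by fastforce
  show ?thesis
    using E_connected[of i j] by (induction rule: rtrancl_induct) (auto dest: edge)
qed

text \<open>
  The Laplacian becomes invertible when the averaging matrix, the projection onto its kernel, is added
  to it; its pseudoinverse is the inverse of the sum minus the averaging matrix.
\<close>

definition averaging :: "real ^ 'v ^ 'v" where
  "averaging = (\<chi> i j. 1 / real CARD('v))"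

lemma laplacian_averaging: "laplacian_matrix L p ** averaging = 0"
  "averaging ** laplacian_matrix L p = 0"
proof -
  have row: "(\<Sum>k\<in>UNIV. laplacian_matrix L p $ i $ k) = 0" for i
    using laplacian_sum[of i "\<lambda>_. 1 :: real"] by (simp add: degree_def)
  have sym: "laplacian_matrix L p $ k $ j = laplacian_matrix L p $ j $ k" for j k
    by (simp add: laplacian_nth p_sym)
  show "laplacian_matrix L p ** averaging = 0"
    by (simp add: matrix_matrix_mult_def averaging_def vec_eq_iff row flip: sum_divide_distrib)
  show "averaging ** laplacian_matrix L p = 0"
    by (simp add: matrix_matrix_mult_def averaging_def vec_eq_iff sym[of _ j for j] row
        flip: sum_divide_distrib)
qed

lemma averaging_idem: "averaging ** averaging = averaging"
  by (simp add: matrix_matrix_mult_def averaging_def vec_eq_iff)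

lemma laplacian_pinv: "laplacian_matrix L p ** moore_penrose (laplacian_matrix L p) = mat 1 - averaging"
proof -
  let ?A = "laplacian_matrix L p"
  \<comment> \<open>Multiplying by \<open>averaging\<close> removes the Laplacian part, so both
    summands annihilate \<open>x\<close>. Then \<open>x\<close> is constant and equals its own
    average, which is 0.\<close>
  have inj: "x = 0" if x: "(?A + averaging) *v x = 0" for x
  proof -
    have "averaging *v ((?A + averaging) *v x) = averaging *v x"
      by (simp add: matrix_vector_mul_assoc matrix_add_ldistrib laplacian_averaging averaging_idem)
    with x have 0: "averaging *v x = 0" by simp
    with x have "?A *v x = 0"
      by (simp add: matrix_vector_mult_add_rdistrib)
    then have "x $ i = x $ j" for i j
      by (intro laplacian_kernel[of "\<lambda>i. x $ i"])
        (simp add: vec_eq_iff matrix_vector_mult_def)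
    then have const: "x = (\<chi> j. x $ i)" for i
      by (simp add: vec_eq_iff)
    have "x $ i = (averaging *v x) $ i" for i
      by (subst (2) const[of i]) (simp add: averaging_def matrix_vector_mult_def)
    with 0 show "x = 0"
      by (simp add: vec_eq_iff)
  qed
  then obtain N where NP: "N ** (?A + averaging) = mat 1"
    using matrix_left_invertible_ker[of "?A + averaging"] by blast
  then have PN: "(?A + averaging) ** N = mat 1"
    by (simp add: matrix_left_right_inverse)
  \<comment> \<open>The sum absorbs into \<open>averaging\<close> from either side, hence so does
    its inverse \<open>N\<close>.\<close>
  have "averaging ** ((?A + averaging) ** N) = averaging ** N"
    by (simp add: matrix_mul_assoc matrix_add_ldistrib laplacian_averaging averaging_idem)
  then have JN: "averaging ** N = averaging"
    by (simp add: PN)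
  have "(N ** (?A + averaging)) ** averaging = N ** averaging"
    by (simp add: matrix_add_rdistrib laplacian_averaging averaging_idem flip: matrix_mul_assoc)
  then have NJ: "N ** averaging = averaging"
    by (simp add: NP)
  let ?B = "N - averaging"
  have AN: "?A ** N = mat 1 - averaging"
    using PN by (simp add: matrix_add_rdistrib JN algebra_simps)
  have NA: "N ** ?A = mat 1 - averaging"
    using NP by (simp add: matrix_add_ldistrib NJ algebra_simps)
  have AB: "?A ** ?B = mat 1 - averaging"
    by (simp add: matrix_diff_ldistrib AN laplacian_averaging)
  have BA: "?B ** ?A = mat 1 - averaging"
    by (simp add: matrix_diff_rdistrib NA laplacian_averaging)
  have tr: "transpose (mat 1 - averaging) = mat 1 - averaging"
    by (auto simp: transpose_def averaging_def vec_eq_iff mat_def)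
  have "is_moore_penrose ?A ?B"
    unfolding is_moore_penrose_def AB BA tr
    by (simp add: matrix_diff_ldistrib matrix_diff_rdistrib laplacian_averaging JN averaging_idem)
  then show ?thesis
    using AB by (simp add: moore_penrose_eq)
qed

text \<open>The projection \<open>mat 1 - averaging\<close> fixes exactly the vectors with zero sum;
  this is where feasibility enters the norm estimate.\<close>

lemma laplacian_pinv_sum:
  fixes y :: "'v \<Rightarrow> 'a::real_vector"
  assumes "(\<Sum>i\<in>UNIV. y i) = 0"
  shows "(\<Sum>k\<in>UNIV. laplacian_matrix L p $ i $ k *\<^sub>R
            (\<Sum>j\<in>UNIV. moore_penrose (laplacian_matrix L p) $ k $ j *\<^sub>R y j)) = y i"
    (is "?lhs = _")
proof -
  let ?A = "laplacian_matrix L p" and ?B = "moore_penrose (laplacian_matrix L p)"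
  have "?lhs = (\<Sum>k\<in>UNIV. \<Sum>j\<in>UNIV. (?A $ i $ k * ?B $ k $ j) *\<^sub>R y j)"
    by (simp add: scaleR_sum_right)
  also have "\<dots> = (\<Sum>j\<in>UNIV. (?A ** ?B) $ i $ j *\<^sub>R y j)"
    by (subst sum.swap) (simp add: matrix_matrix_mult_def scaleR_sum_left)
  also have "\<dots> = (\<Sum>j\<in>UNIV. (if i = j then y j else 0) - (1 / real CARD('v)) *\<^sub>R y j)"
    unfolding laplacian_pinv
    by (intro sum.cong refl) (simp add: mat_def averaging_def scaleR_diff_left)
  also have "\<dots> = y i"
    using assms by (simp add: sum_subtractf flip: scaleR_sum_right)
  finally show ?thesis .
qed

lemma matrix_inv_degree_matrix:
  "matrix_inv (degree_matrix L p) = (\<chi> i j. if i = j then L / degree i else 0)"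
proof (rule matrix_inv_eq)
  have [simp]: "degree i \<noteq> 0" for i
    using degree_pos[of i] by simp
  have *: "degree_matrix L p = (\<chi> i j. if i = j then degree i / L else 0)"
    by (simp add: degree_matrix_def off_diagonal_sum vec_eq_iff)
  show "degree_matrix L p ** (\<chi> i j. if i = j then L / degree i else 0) = mat 1"
    "(\<chi> i j. if i = j then L / degree i else 0) ** degree_matrix L p = mat 1"
    unfolding * using L_pos
    by (auto simp: matrix_matrix_mult_def mat_def vec_eq_iff if_distrib[of "\<lambda>x. x * _"] cong: if_cong)
qed

text \<open>\<open>edge_form r r / L\<close> is the square of the norm whose dual is \<open>dual_norm_K\<close> on the feasible points.\<close>

definition edge_form :: "('y::real_inner, 'z::real_inner, 'v) point \<Rightarrow> ('y, 'z, 'v) point \<Rightarrow> real" where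
  "edge_form r w = (1 / 2) * (\<Sum>(i, j)\<in>E. p i j * (r \<bullet> pair_proj i j w))"

text \<open>The quadratic in \<open>s\<close> to which \<open>discriminant_le\<close> is applied to
  obtain Cauchy-Schwarz for \<open>edge_form\<close>.\<close>

lemma edge_form_diff_scaleR:
  "edge_form (r - s *\<^sub>R w) (r - s *\<^sub>R w) = edge_form r r - 2 * edge_form r w * s + edge_form w w * s\<^sup>2"
proof -
  have sym: "w \<bullet> pair_proj i j r = r \<bullet> pair_proj i j w" for i j
    by (simp add: inner_pair_proj inner_commute)
  have *: "(r - s *\<^sub>R w) \<bullet> pair_proj i j (r - s *\<^sub>R w)
      = r \<bullet> pair_proj i j r - 2 * s * (r \<bullet> pair_proj i j w) + s\<^sup>2 * (w \<bullet> pair_proj i j w)" for i j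
    by (simp add: linear_diff[OF linear_pair_proj] linear_scale[OF linear_pair_proj] inner_diff_left
        inner_diff_right sym power2_eq_square algebra_simps)
  show ?thesis
    unfolding edge_form_def *
    by (simp add: sum.distrib sum_subtractf case_prod_unfold sum_distrib_left algebra_simps)
qed

lemma edge_form_norm: "edge_form r r = (1 / 2) * (\<Sum>(i, j)\<in>E. p i j * (norm (pair_proj i j r))\<^sup>2)"
  unfolding edge_form_def by (intro arg_cong2[where f = "(*)"] refl sum.cong) (auto simp: norm_pair_proj edge_neq)

lemma edge_form_nonneg: "0 \<le> edge_form r r"
  unfolding edge_form_norm by (intro mult_nonneg_nonneg sum_nonneg) (auto simp: p_nonneg)

text \<open>Identifies \<open>edge_form\<close> with L times the bilinear form of the block diagonal
  matrix K.\<close>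

lemma edge_form_eq:
  "edge_form r w = L * (\<Sum>i\<in>UNIV. fst (r $ i) \<bullet> (\<Sum>j\<in>UNIV. laplacian_matrix L p $ i $ j *\<^sub>R fst (w $ j)))
                 + (\<Sum>i\<in>UNIV. degree i * (snd (r $ i) \<bullet> snd (w $ i)))"
proof -
  have "edge_form r w = (1 / 4) * (\<Sum>i\<in>UNIV. \<Sum>j\<in>UNIV. p i j * ((fst (r $ i) - fst (r $ j)) \<bullet> (fst (w $ i) - fst (w $ j))))
      + (1 / 2) * ((\<Sum>i\<in>UNIV. \<Sum>j\<in>UNIV. p i j * (snd (r $ i) \<bullet> snd (w $ i)))
                 + (\<Sum>i\<in>UNIV. \<Sum>j\<in>UNIV. p i j * (snd (r $ j) \<bullet> snd (w $ j))))"
    unfolding edge_form_def sum_edges inner_pair_proj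
    by (simp add: sum_distrib_left sum.distrib distrib_left)
  also have "(\<Sum>i\<in>UNIV. \<Sum>j\<in>UNIV. p i j * (snd (r $ j) \<bullet> snd (w $ j)))
      = (\<Sum>i\<in>UNIV. \<Sum>j\<in>UNIV. p i j * (snd (r $ i) \<bullet> snd (w $ i)))"
    by (subst sum.swap) (simp add: p_sym)
  finally show ?thesis
    unfolding laplacian_form by (simp add: degree_def sum_distrib_right)
qed

text \<open>Cauchy-Schwarz for \<open>edge_form\<close>, applied to \<open>r\<close> and the image
  of \<open>x\<close> under the pseudoinverse of K.\<close>

lemma inner_le_dual_norm_K:
  assumes x: "x \<in> feasible"
  shows "r \<bullet> x \<le> sqrt (edge_form r r / L) * dual_norm_K L p x"
proof -
  let ?B = "moore_penrose (laplacian_matrix L p)"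
  \<comment> \<open>The pseudoinverse of K applied to \<open>x\<close>. As \<open>x\<close> is
    feasible, K maps \<open>w\<close> back to \<open>x\<close>, so \<open>edge_form u w\<close> is
    \<open>L * (u \<bullet> x)\<close>; and \<open>w \<bullet> x\<close> is the squared dual norm of
    \<open>x\<close>.\<close>
  define w where "w = (\<chi> i. (\<Sum>j\<in>UNIV. ?B $ i $ j *\<^sub>R fst (x $ j), (L / degree i) *\<^sub>R snd (x $ i)))"
  have [simp]: "degree i \<noteq> 0" for i
    using degree_pos[of i] by simp
  have form: "edge_form u w = L * (u \<bullet> x)" for u
    using x unfolding edge_form_eq
    by (simp add: w_def laplacian_pinv_sum feasible_def inner_vec_def inner_prod_def sum.distrib
        sum_distrib_left algebra_simps)
  let ?N = "kron_form ?B (\<lambda>i. fst (x $ i)) + kron_form (matrix_inv (degree_matrix L p)) (\<lambda>i. snd (x $ i))"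
  have N: "?N = w \<bullet> x"
    unfolding kron_form_def matrix_inv_degree_matrix
    by (simp add: w_def inner_vec_def inner_prod_def sum.distrib inner_sum_left
        inner_sum_right inner_commute
        if_distrib[of "\<lambda>c. c * _"] cong: if_cong)
  have "(edge_form r w)\<^sup>2 \<le> edge_form r r * edge_form w w"
    using edge_form_nonneg[of "r - s *\<^sub>R w" for s] edge_form_nonneg[of w]
    by (intro discriminant_le) (simp_all add: edge_form_diff_scaleR)
  then have "(r \<bullet> x)\<^sup>2 \<le> edge_form r r / L * (w \<bullet> x)"
    using L_pos by (simp add: form field_simps power2_eq_square)
  then have "\<bar>r \<bullet> x\<bar> \<le> sqrt (edge_form r r / L * (w \<bullet> x))"
    by (metis real_sqrt_abs real_sqrt_le_iff)
  then show ?thesis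
    unfolding dual_norm_K_def N real_sqrt_mult by simp
qed

end

section \<open>A single run of the method\<close>

locale smooth_problem = edge_graph E p L
  for E :: "('v::finite \<times> 'v) set" and p :: "'v \<Rightarrow> 'v \<Rightarrow> real" and L :: real +
  fixes f :: "('y::real_inner, 'z::real_inner, 'v) point \<Rightarrow> real"
    and g :: "('y, 'z, 'v) point \<Rightarrow> ('y, 'z, 'v) point"
  assumes f_convex: "convex_on UNIV f"
    and f_grad: "\<And>u. GDERIV f u :> g u"
    and lipschitz_edge: "\<And>i j u h h'. (i, j) \<in> E \<Longrightarrow>
         norm ((g (u + axis i h + axis j h') $ i, g (u + axis i h + axis j h') $ j) - (g u $ i, g u $ j))
           \<le> L * norm (h, h')"
begin

text \<open>Against \<open>d\<close> only the blocks \<open>i\<close> and \<open>j\<close> of a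
  gradient count, so \<open>d\<close> is identified with the pair \<open>(h, h')\<close> and the
  Lipschitz condition combines with Cauchy-Schwarz in the product space.\<close>

lemma edge_descent:
  assumes e: "(i, j) \<in> E" and d: "d \<in> edge_space i j"
  shows "f (u + d) \<le> f u + g u \<bullet> d + L / 2 * (norm d)\<^sup>2"
proof (rule descent_along[OF f_grad])
  fix t :: real
  assume t: "0 \<le> t"
  obtain h h' where dh: "d = axis i h + axis j h'"
    using d unfolding edge_space_def by blast
  have inner_d: "w \<bullet> d = (w $ i, w $ j) \<bullet> (h, h')" for w
    by (simp add: dh inner_add_right inner_axis)
  have "norm d = norm (h, h')"
    unfolding norm_eq_sqrt_inner inner_d using edge_neq[OF e] by (simp add: dh axis_def)
  moreover have "t *\<^sub>R d = axis i (t *\<^sub>R h) + axis j (t *\<^sub>R h')"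
    by (simp add: dh vec_eq_iff axis_def scaleR_add_right)
  ultimately have "norm ((g (u + t *\<^sub>R d) $ i, g (u + t *\<^sub>R d) $ j) - (g u $ i, g u $ j)) \<le> L * (t * norm d)"
    using lipschitz_edge[OF e, of u "t *\<^sub>R h" "t *\<^sub>R h'"] t
    by (simp add: add.assoc flip: scaleR_Pair)
  then have "norm ((g (u + t *\<^sub>R d) $ i, g (u + t *\<^sub>R d) $ j) - (g u $ i, g u $ j)) * norm d
      \<le> L * (t * norm d) * norm d"
    by (rule mult_right_mono) simp
  moreover have "(g (u + t *\<^sub>R d) - g u) \<bullet> d
      \<le> norm ((g (u + t *\<^sub>R d) $ i, g (u + t *\<^sub>R d) $ j) - (g u $ i, g u $ j)) * norm d"
    unfolding inner_d \<open>norm d = norm (h, h')\<close>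
    by (rule order_trans[OF _ norm_cauchy_schwarz]) simp
  ultimately show "(g (u + t *\<^sub>R d) - g u) \<bullet> d \<le> L * t * (norm d)\<^sup>2"
    by (simp add: power2_eq_square mult_ac)
qed

text \<open>The Lipschitz hypothesis concerns one edge at a time; convexity and descent along each
  of the two edges supply the mixed estimate.\<close>

lemma edge_cross_lipschitz:
  assumes "(i, j) \<in> E" "d \<in> edge_space i j" "(i', j') \<in> E" "d' \<in> edge_space i' j'"
  shows "(g (u + d') - g u) \<bullet> d \<le> L * norm d' * norm d"
  using assms L_pos
  by (intro cross_lipschitz[OF f_convex f_grad] edge_descent[where i = i' and j = j']
      edge_descent[where i = i and j = j] scaleR_in_edge_space) auto

lemma gap_le:
  assumes x: "x \<in> feasible" and xs: "xs \<in> optimal_set f"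
  shows "f x - f xs \<le> sqrt (edge_form (g x) (g x) / L) * dual_norm_K L p (x - xs)"
proof -
  have "x - xs \<in> feasible"
    using x xs by (simp add: feasible_def optimal_set_def sum_subtractf)
  then have "g x \<bullet> (x - xs) \<le> sqrt (edge_form (g x) (g x) / L) * dual_norm_K L p (x - xs)"
    by (rule inner_le_dual_norm_K)
  moreover have "f x + g x \<bullet> (xs - x) \<le> f xs"
    by (rule convex_gradient_le[OF f_convex f_grad])
  ultimately show ?thesis
    by (simp add: inner_diff_right)
qed

end

text \<open>After swapping the sums, \<open>t\<close> lies in the window of \<open>k\<close> only
  for \<open>k\<close> in \<open>{t<..t + \<tau>}\<close>, so each term is counted at most \<tau>
  times.\<close>

lemma sum_window_le:
  fixes a :: "nat \<Rightarrow> real"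
  assumes "\<And>t. 0 \<le> a t"
  shows "(\<Sum>k<n. \<Sum>t\<in>{k - \<tau>..<k}. a t) \<le> real \<tau> * (\<Sum>t<n. a t)"
proof -
  have "(\<Sum>k<n. \<Sum>t\<in>{k - \<tau>..<k}. a t) = (\<Sum>k<n. \<Sum>t<n. if k - \<tau> \<le> t \<and> t < k then a t else 0)"
  proof (rule sum.cong[OF refl])
    fix k assume "k \<in> {..<n}"
    then have "{k - \<tau>..<k} = {..<n} \<inter> {t. k - \<tau> \<le> t \<and> t < k}"
      by auto
    then show "(\<Sum>t\<in>{k - \<tau>..<k}. a t) = (\<Sum>t<n. if k - \<tau> \<le> t \<and> t < k then a t else 0)"
      by (simp add: sum.inter_restrict)
  qed
  also have "\<dots> = (\<Sum>t<n. \<Sum>k<n. if k - \<tau> \<le> t \<and> t < k then a t else 0)"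
    by (rule sum.swap)
  also have "\<dots> \<le> (\<Sum>t<n. real \<tau> * a t)"
  proof (rule sum_mono)
    fix t
    have "(\<Sum>k<n. if k - \<tau> \<le> t \<and> t < k then a t else 0)
        = real (card ({..<n} \<inter> {k. k - \<tau> \<le> t \<and> t < k})) * a t"
      by (simp add: sum.If_cases)
    also have "\<dots> \<le> real \<tau> * a t"
    proof (rule mult_right_mono)
      have "card ({..<n} \<inter> {k. k - \<tau> \<le> t \<and> t < k}) \<le> card {t<..t + \<tau>}"
        by (rule card_mono) auto
      then show "real (card ({..<n} \<inter> {k. k - \<tau> \<le> t \<and> t < k})) \<le> real \<tau>"
        by simp
    qed (rule assms)
    finally show "(\<Sum>k<n. if k - \<tau> \<le> t \<and> t < k then a t else 0) \<le> real \<tau> * a t" .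
  qed
  finally show ?thesis
    by (simp add: sum_distrib_left)
qed

lemma square_diff_le: "u\<^sup>2 - v\<^sup>2 \<le> 2 * u * (u - v)" for u v :: real
  using zero_le_power2[of "u - v"] by (simp add: power2_eq_square algebra_simps)

section \<open>Estimates along a fixed sequence of edges, without probability\<close>

locale delayed_run = smooth_problem E p L f g
  for E :: "('v::finite \<times> 'v) set" and p L
    and f :: "('y::real_inner, 'z::real_inner, 'v) point \<Rightarrow> real" and g +
  fixes D :: "nat \<Rightarrow> nat" and \<tau> :: nat and \<alpha> :: real
    and X :: "nat \<Rightarrow> ('y, 'z, 'v) point" and i j :: "nat \<Rightarrow> 'v"
  assumes delay_le: "D k \<le> k"
    and delay_bound: "k - D k \<le> \<tau>"
    and \<alpha>_pos: "\<alpha> > 0"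
    and edge: "(i k, j k) \<in> E"
    and step: "X (Suc k) = X k - (\<alpha> / L) *\<^sub>R pair_proj (i k) (j k) (g (X (D k)))"
begin

definition stepsize :: "nat \<Rightarrow> real" where
  "stepsize k = norm (X (Suc k) - X k)"

lemma stepsize_nonneg: "0 \<le> stepsize k"
  by (simp add: stepsize_def)

lemma stepsize_eq: "stepsize k = \<alpha> / L * norm (pair_proj (i k) (j k) (g (X (D k))))"
  using \<alpha>_pos L_pos by (simp add: stepsize_def step)

lemma increment: "X (Suc k) - X k \<in> edge_space (i k) (j k)"
  using scaleR_in_edge_space[OF pair_proj_in_edge_space, of "- (\<alpha> / L)" "i k" "j k" "g (X (D k))"]
  by (simp add: step)

text \<open>Telescoping over the steps from \<open>m\<close> to \<open>n\<close>. Each increment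
  lies in the space of its own edge, while \<open>d\<close> may belong to any other one.\<close>

lemma gradient_variation_le:
  assumes "(a, b) \<in> E" "d \<in> edge_space a b" "m \<le> n"
  shows "(g (X n) - g (X m)) \<bullet> d \<le> L * (\<Sum>t\<in>{m..<n}. stepsize t) * norm d"
  using \<open>m \<le> n\<close>
proof (induction n rule: dec_induct)
  case (step n)
  have "(g (X (Suc n)) - g (X n)) \<bullet> d \<le> L * stepsize n * norm d"
    using edge_cross_lipschitz[OF assms(1,2) edge[of n] increment[of n], of "X n"] by (simp add: stepsize_def)
  with step show ?case
    by (simp add: inner_diff_left algebra_simps)
qed simp

text \<open>\<open>D\<close> need not be monotone, so two consecutive read points can occur in
  either order.\<close>

lemma gradient_variation:
  assumes "(a, b) \<in> E" "d \<in> edge_space a b"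
  shows "(g (X n) - g (X m)) \<bullet> d \<le> L * (\<Sum>t\<in>{min m n..<max m n}. stepsize t) * norm d"
proof (cases "m \<le> n")
  case True
  with gradient_variation_le[OF assms True] show ?thesis by (simp add: min_def max_def)
next
  case False
  have "- d \<in> edge_space a b"
    using scaleR_in_edge_space[OF assms(2), of "- 1"] by simp
  from gradient_variation_le[OF assms(1) this, of n m] False show ?thesis
    by (simp add: min_def max_def inner_diff_left)
qed

lemma projected_gradient_variation:
  assumes "(a, b) \<in> E"
  shows "norm (pair_proj a b (g (X m)))
    \<le> norm (pair_proj a b (g (X n))) + L * (\<Sum>t\<in>{min m n..<max m n}. stepsize t)" (is "_ \<le> _ + L * ?S")
proof -
  let ?w = "g (X n) - g (X m)"
  \<comment> \<open>The variation is tested against its own projection, and one factor of the norm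
    is then cancelled.\<close>
  have "(norm (pair_proj a b ?w))\<^sup>2 \<le> L * ?S * norm (pair_proj a b ?w)"
    unfolding norm_pair_proj[OF edge_neq[OF assms]]
    by (rule gradient_variation[OF assms pair_proj_in_edge_space])
  then have "norm (pair_proj a b ?w) \<le> L * ?S"
    using L_pos by (cases "pair_proj a b ?w = 0") (auto simp: power2_eq_square stepsize_nonneg sum_nonneg)
  moreover have "norm (pair_proj a b (g (X m))) \<le> norm (pair_proj a b (g (X n))) + norm (pair_proj a b ?w)"
    unfolding linear_diff[OF linear_pair_proj] by norm
  ultimately show ?thesis by simp
qed

text \<open>With \<open>m = D k\<close> and \<open>n = D (Suc k)\<close> this compares consecutive
  expected squared steps. On each edge U^2 - V^2 \<le> 2U(U - V), U - V is at most \<alpha> times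
  the sum of the step lengths, and 2ab \<le> a^2 + b^2 separates the products. The edges are then
  averaged with the weights p/2, of total 1.\<close>

lemma edge_form_variation:
  "(\<alpha> / L)\<^sup>2 * (edge_form (g (X m)) (g (X m)) - edge_form (g (X n)) (g (X n)))
     \<le> \<alpha> * (\<Sum>t\<in>{min m n..<max m n}. (\<alpha> / L)\<^sup>2 * edge_form (g (X m)) (g (X m)) + (stepsize t)\<^sup>2)"
proof -
  let ?T = "{min m n..<max m n}" and ?u = "\<lambda>a b. \<alpha> / L * norm (pair_proj a b (g (X m)))"
    and ?v = "\<lambda>a b. \<alpha> / L * norm (pair_proj a b (g (X n)))"
  have edge_le: "(?u a b)\<^sup>2 - (?v a b)\<^sup>2 \<le> \<alpha> * (\<Sum>t\<in>?T. (?u a b)\<^sup>2 + (stepsize t)\<^sup>2)"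
    if e: "(a, b) \<in> E" for a b
  proof -
    let ?U = "?u a b" and ?V = "?v a b"
    have "?U \<le> \<alpha> / L * (norm (pair_proj a b (g (X n))) + L * (\<Sum>t\<in>?T. stepsize t))"
      using projected_gradient_variation[OF e, of m n] \<alpha>_pos L_pos by (intro mult_left_mono) auto
    then have "?U - ?V \<le> \<alpha> * (\<Sum>t\<in>?T. stepsize t)"
      using L_pos by (simp add: distrib_left)
    moreover have "0 \<le> ?U"
      using \<alpha>_pos L_pos by simp
    ultimately have "2 * ?U * (?U - ?V) \<le> 2 * ?U * (\<alpha> * (\<Sum>t\<in>?T. stepsize t))"
      by (intro mult_left_mono) auto
    also have "\<dots> = \<alpha> * (\<Sum>t\<in>?T. 2 * ?U * stepsize t)"
      by (simp add: sum_distrib_left sum_divide_distrib mult_ac)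
    also have "\<dots> \<le> \<alpha> * (\<Sum>t\<in>?T. ?U\<^sup>2 + (stepsize t)\<^sup>2)"
      using \<alpha>_pos by (intro mult_left_mono sum_mono sum_squares_bound) auto
    finally have "2 * ?U * (?U - ?V) \<le> \<alpha> * (\<Sum>t\<in>?T. ?U\<^sup>2 + (stepsize t)\<^sup>2)" .
    moreover have "?U\<^sup>2 - ?V\<^sup>2 \<le> 2 * ?U * (?U - ?V)"
      by (rule square_diff_le)
    ultimately show ?thesis by linarith
  qed
  have form: "(\<alpha> / L)\<^sup>2 * edge_form r r = (1 / 2) * (\<Sum>(a, b)\<in>E. p a b * (\<alpha> / L * norm (pair_proj a b r))\<^sup>2)" for r
    unfolding edge_form_norm power_mult_distrib
    by (simp add: sum_distrib_left case_prod_unfold mult_ac)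
  have average: "(1 / 2) * (\<Sum>(a, b)\<in>E. p a b * (\<alpha> * (\<Sum>t\<in>T. U a b + s t)))
      = \<alpha> * (\<Sum>t\<in>T. (1 / 2) * (\<Sum>(a, b)\<in>E. p a b * U a b) + (1 / 2) * (\<Sum>(a, b)\<in>E. p a b) * s t)"
    for T :: "nat set" and U s
    by (simp add: case_prod_unfold sum_distrib_left sum_distrib_right sum.swap[of _ T] distrib_left sum.distrib mult_ac
        del: sum_constant)
  have "(\<alpha> / L)\<^sup>2 * (edge_form (g (X m)) (g (X m)) - edge_form (g (X n)) (g (X n)))
      = (1 / 2) * (\<Sum>(a, b)\<in>E. p a b * ((?u a b)\<^sup>2 - (?v a b)\<^sup>2))"
    unfolding right_diff_distrib form by (simp add: sum_subtractf case_prod_unfold)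
  also have "\<dots> \<le> (1 / 2) * (\<Sum>(a, b)\<in>E. p a b * (\<alpha> * (\<Sum>t\<in>?T. (?u a b)\<^sup>2 + (stepsize t)\<^sup>2)))"
    using edge_le by (intro mult_left_mono sum_mono) (auto simp: p_nonneg intro!: mult_left_mono)
  also have "\<dots> = \<alpha> * (\<Sum>t\<in>?T. (1 / 2) * (\<Sum>(a, b)\<in>E. p a b * (?u a b)\<^sup>2)
      + (1 / 2) * (\<Sum>(a, b)\<in>E. p a b) * (stepsize t)\<^sup>2)"
    by (rule average)
  finally show ?thesis
    by (simp add: form p_sum)
qed

text \<open>The current gradient is split into the stale one, whose product with the step is
  -(L/\<alpha>) times the squared step length, and the drift since the read, which is paid for by
  the lengths of the last \<tau> steps.\<close>

lemma step_descent:
  "f (X (Suc k)) \<le> f (X k) - L * (1 / \<alpha> - (1 + real \<tau>) / 2) * (stepsize k)\<^sup>2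
     + L / 2 * (\<Sum>t\<in>{k - \<tau>..<k}. (stepsize t)\<^sup>2)"
proof -
  let ?d = "X (Suc k) - X k" and ?r = "g (X (D k))" and ?P = "pair_proj (i k) (j k) (g (X (D k)))"
  have d: "?d = - (\<alpha> / L) *\<^sub>R ?P"
    by (simp add: step)
  have "f (X k + ?d) \<le> f (X k) + g (X k) \<bullet> ?d + L / 2 * (norm ?d)\<^sup>2"
    by (rule edge_descent[OF edge increment])
  moreover have "?r \<bullet> ?d = - (L / \<alpha>) * (stepsize k)\<^sup>2"
    unfolding d stepsize_eq power_mult_distrib norm_pair_proj[OF edge_neq[OF edge]]
    using \<alpha>_pos L_pos by (simp add: field_simps power2_eq_square)
  moreover have "(g (X k) - ?r) \<bullet> ?d \<le> L / 2 * (\<Sum>t\<in>{k - \<tau>..<k}. (stepsize t)\<^sup>2) + L / 2 * real \<tau> * (stepsize k)\<^sup>2"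
  proof -
    have "(g (X k) - ?r) \<bullet> ?d \<le> L * (\<Sum>t\<in>{D k..<k}. stepsize t) * stepsize k"
      using gradient_variation_le[OF edge increment delay_le] unfolding stepsize_def .
    also have "\<dots> \<le> L * (\<Sum>t\<in>{k - \<tau>..<k}. stepsize t) * stepsize k"
      using delay_bound[of k] L_pos
      by (intro mult_right_mono mult_left_mono sum_mono2) (auto simp: stepsize_nonneg)
    also have "\<dots> = L / 2 * (\<Sum>t\<in>{k - \<tau>..<k}. 2 * stepsize t * stepsize k)"
      by (simp add: sum_distrib_left sum_distrib_right mult_ac)
    also have "\<dots> \<le> L / 2 * (\<Sum>t\<in>{k - \<tau>..<k}. (stepsize t)\<^sup>2 + (stepsize k)\<^sup>2)"
      using L_pos by (intro mult_left_mono sum_mono sum_squares_bound) auto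
    \<comment> \<open>With truncated subtraction, \<open>k - (k - \<tau>)\<close> is the minimum of
      \<open>k\<close> and \<tau>.\<close>
    also have "\<dots> = L / 2 * (\<Sum>t\<in>{k - \<tau>..<k}. (stepsize t)\<^sup>2) + L / 2 * (real (k - (k - \<tau>)) * (stepsize k)\<^sup>2)"
      by (simp add: sum.distrib distrib_left)
    also have "\<dots> \<le> L / 2 * (\<Sum>t\<in>{k - \<tau>..<k}. (stepsize t)\<^sup>2) + L / 2 * (real \<tau> * (stepsize k)\<^sup>2)"
      using L_pos by (intro add_left_mono mult_left_mono mult_right_mono) auto
    finally show ?thesis by (simp add: mult_ac)
  qed
  ultimately show ?thesis
    by (simp add: inner_diff_left stepsize_def[symmetric] algebra_simps add_divide_distrib)
qed

text \<open>\<open>step_descent\<close> does not force a decrease at every step. Summed from the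
  start, however, every squared step length is charged at most \<tau> times, so its total
  coefficient is nonpositive.\<close>

lemma run_in_sublevel:
  assumes "\<alpha> * (1 + 2 * real \<tau>) \<le> 2"
  shows "f (X n) \<le> f (X 0)"
proof -
  let ?s = "\<lambda>k. (stepsize k)\<^sup>2"
  have "f (X n) \<le> f (X 0) - L * (1 / \<alpha> - (1 + real \<tau>) / 2) * (\<Sum>k<n. ?s k)
     + L / 2 * (\<Sum>k<n. \<Sum>t\<in>{k - \<tau>..<k}. ?s t)"
  proof (induction n)
    case (Suc n)
    with step_descent[of n] show ?case by (simp add: algebra_simps)
  qed simp
  also have "\<dots> \<le> f (X 0) - L * (1 / \<alpha> - (1 + real \<tau>) / 2) * (\<Sum>k<n. ?s k) + L / 2 * (real \<tau> * (\<Sum>k<n. ?s k))"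
    using L_pos by (intro add_left_mono mult_left_mono sum_window_le) auto
  also have "\<dots> = f (X 0) - L / (2 * \<alpha>) * (2 - \<alpha> * (1 + 2 * real \<tau>)) * (\<Sum>k<n. ?s k)"
    using \<alpha>_pos by (simp add: field_simps)
  also have "\<dots> \<le> f (X 0)"
    using assms L_pos \<alpha>_pos by (simp add: sum_nonneg)
  finally show ?thesis .
qed

lemma run_feasible: "X 0 \<in> feasible \<Longrightarrow> X n \<in> feasible"
proof (induction n)
  case (Suc n)
  then show ?case
    using sum_fst_pair_proj[of "i n" "j n" "g (X (D n))"]
    by (simp add: step feasible_def sum_subtractf flip: scaleR_sum_right)
qed simp

end

section \<open>The random edges\<close>

locale random_run = smooth_problem E p L f g + prob_space M
  for E :: "('v::finite \<times> 'v) set" and p L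
    and f :: "('y::real_inner, 'z::real_inner, 'v) point \<Rightarrow> real" and g
    and M :: "'w measure" +
  fixes D :: "nat \<Rightarrow> nat" and \<tau> :: nat and \<alpha> :: real
    and I J :: "nat \<Rightarrow> 'w \<Rightarrow> 'v"
    and x0 :: "('y, 'z, 'v) point"
    and x :: "nat \<Rightarrow> 'w \<Rightarrow> ('y, 'z, 'v) point"
  assumes edges_indep: "indep_vars (\<lambda>_. count_space UNIV) (\<lambda>k \<omega>. {I k \<omega>, J k \<omega>}) UNIV"
    and edges_law: "\<And>k i j. (i, j) \<in> E \<Longrightarrow> prob {\<omega> \<in> space M. {I k \<omega>, J k \<omega>} = {i, j}} = p i j"
    and delay_le: "\<And>k. D k \<le> k"
    and delay_bound: "\<And>k. k - D k \<le> \<tau>"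
    and \<alpha>_pos: "\<alpha> > 0"
    and x_init: "\<And>\<omega>. \<omega> \<in> space M \<Longrightarrow> x 0 \<omega> = x0"
    and x_step: "\<And>k \<omega>. \<omega> \<in> space M \<Longrightarrow>
      x (Suc k) \<omega> = pair_update L \<alpha> (g (x (D k) \<omega>)) (I k \<omega>) (J k \<omega>) (x k \<omega>)"
    and E_sym: "sym E"
begin

section \<open>Functions of the edges drawn so far\<close>

definition history :: "nat \<Rightarrow> 'w \<Rightarrow> nat \<Rightarrow> 'v set" where
  "history n \<omega> = (\<lambda>k\<in>{..<n}. {I k \<omega>, J k \<omega>})"

text \<open>Takes the place of measurability with respect to the past. As there are only finitely
  many histories, it already yields measurability and boundedness.\<close>

definition adapted :: "nat \<Rightarrow> ('w \<Rightarrow> 'a) \<Rightarrow> bool" where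
  "adapted n h \<longleftrightarrow> (\<forall>\<omega>\<in>space M. \<forall>\<omega>'\<in>space M. history n \<omega> = history n \<omega>' \<longrightarrow> h \<omega> = h \<omega>')"

lemma adapted_factor:
  assumes "adapted n h"
  obtains \<Phi> where "\<And>\<omega>. \<omega> \<in> space M \<Longrightarrow> h \<omega> = \<Phi> (history n \<omega>)"
proof
  fix \<omega> assume \<omega>: "\<omega> \<in> space M"
  let ?w = "SOME \<omega>'. \<omega>' \<in> space M \<and> history n \<omega>' = history n \<omega>"
  have "?w \<in> space M \<and> history n ?w = history n \<omega>"
    by (rule someI[where P = "\<lambda>\<omega>'. \<omega>' \<in> space M \<and> history n \<omega>' = history n \<omega>" and x = \<omega>])
      (simp add: \<omega>)
  then show "h \<omega> = (\<lambda>s. h (SOME \<omega>'. \<omega>' \<in> space M \<and> history n \<omega>' = s)) (history n \<omega>)"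
    using assms \<omega> unfolding adapted_def by metis
qed

lemma history_eqD: "history n \<omega> = history n \<omega>' \<Longrightarrow> k < n \<Longrightarrow> {I k \<omega>, J k \<omega>} = {I k \<omega>', J k \<omega>'}"
  by (drule fun_cong[where x = k]) (simp only: history_def restrict_apply lessThan_iff if_True)

lemma history_mono: "history n \<omega> = history n \<omega>' \<Longrightarrow> m \<le> n \<Longrightarrow> history m \<omega> = history m \<omega>'"
  using history_eqD[of n \<omega> \<omega>'] unfolding history_def[of m] by (intro restrict_ext) simp

lemma adapted_mono: "adapted m h \<Longrightarrow> m \<le> n \<Longrightarrow> adapted n h"
  unfolding adapted_def using history_mono by blast

lemma adapted_iterate: "adapted n (x n)"
  unfolding adapted_def
proof (induction n rule: less_induct)
  case (less n)
  show ?case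
  proof (cases n)
    case 0
    then show ?thesis by (simp add: x_init)
  next
    case (Suc k)
    show ?thesis
    proof (intro ballI impI)
      fix \<omega> \<omega>' assume \<omega>: "\<omega> \<in> space M" "\<omega>' \<in> space M" and eq: "history n \<omega> = history n \<omega>'"
      have "x m \<omega> = x m \<omega>'" if "m \<le> k" for m
      proof -
        have "history m \<omega> = history m \<omega>'"
          using history_mono[OF eq] that Suc by simp
        moreover have "m < n"
          using that Suc by simp
        ultimately show ?thesis
          using less \<omega> by blast
      qed
      then have "x k \<omega> = x k \<omega>'" "x (D k) \<omega> = x (D k) \<omega>'"
        using delay_le[of k] by auto
      moreover have "{I k \<omega>, J k \<omega>} = {I k \<omega>', J k \<omega>'}"
        using history_eqD[OF eq, of k] Suc by simp
      \<comment> \<open>The history records unordered pairs only; the symmetry of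
        \<open>pair_proj\<close> makes them determine the step.\<close>
      then have "pair_proj (I k \<omega>) (J k \<omega>) r = pair_proj (I k \<omega>') (J k \<omega>') r"
        for r :: "('y, 'z, 'v) point"
        unfolding doubleton_eq_iff using pair_proj_commute by (elim disjE conjE) (simp_all only:)
      ultimately show "x n \<omega> = x n \<omega>'"
        by (simp only: Suc x_step[OF \<omega>(1)] x_step[OF \<omega>(2)] pair_update_eq)
    qed
  qed
qed

lemma adapted_iterates:
  assumes "\<And>\<omega> \<omega>'. \<omega> \<in> space M \<Longrightarrow> \<omega>' \<in> space M \<Longrightarrow> (\<And>m. m \<le> n \<Longrightarrow> x m \<omega> = x m \<omega>') \<Longrightarrow> h \<omega> = h \<omega>'"
  shows "adapted n h"
  using assms adapted_mono[OF adapted_iterate] unfolding adapted_def by blast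

lemma PiM_count_space_subsets: "PiM K (\<lambda>_. count_space (UNIV :: 'v set set)) = count_space (PiE K (\<lambda>_. UNIV))"
  if "finite K" for K :: "nat set"
  using that by (intro count_space_PiM_finite) (auto intro: countable_finite)

lemma measurable_edge: "(\<lambda>\<omega>. {I k \<omega>, J k \<omega>}) \<in> measurable M (count_space UNIV)"
  using edges_indep unfolding indep_vars_def by auto

lemma measurable_history: "history n \<in> measurable M (PiM {..<n} (\<lambda>_. count_space UNIV))"
  unfolding history_def by (intro measurable_restrict measurable_edge)

lemma integrable_adapted:
  fixes h :: "'w \<Rightarrow> real"
  assumes "adapted n h"
  shows "integrable M h"
proof -
  obtain \<Phi> where \<Phi>: "\<And>\<omega>. \<omega> \<in> space M \<Longrightarrow> h \<omega> = \<Phi> (history n \<omega>)"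
    using adapted_factor[OF assms] by blast
  let ?P = "PiE {..<n} (\<lambda>_. UNIV :: 'v set set)"
  have fin: "finite ?P"
    by (intro finite_PiE) auto
  have "(\<lambda>\<omega>. \<Phi> (history n \<omega>)) \<in> borel_measurable M"
    using measurable_history[of n]
    by (rule measurable_compose) (simp add: PiM_count_space_subsets)
  moreover have "norm (\<Phi> (history n \<omega>)) \<le> (\<Sum>s\<in>?P. norm (\<Phi> s))" for \<omega>
    by (rule member_le_sum[OF _ _ fin]) (auto simp: history_def)
  ultimately have "integrable M (\<lambda>\<omega>. \<Phi> (history n \<omega>))"
    by (intro integrable_const_bound) auto
  then show ?thesis
    by (simp add: \<Phi> cong: Bochner_Integration.integrable_cong)
qed

text \<open>\<open>h\<close> depends on the edges with index below \<open>k\<close> only, and edge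
  \<open>k\<close> is independent of these.\<close>

lemma expectation_at_edge:
  fixes h :: "'w \<Rightarrow> real"
  assumes h: "adapted k h" and e: "(i, j) \<in> E"
  shows "expectation (\<lambda>\<omega>. of_bool ({I k \<omega>, J k \<omega>} = {i, j}) * h \<omega>) = p i j * expectation h"
    and "integrable M (\<lambda>\<omega>. of_bool ({I k \<omega>, J k \<omega>} = {i, j}) * h \<omega>)"
proof -
  obtain \<Phi> where \<Phi>: "\<And>\<omega>. \<omega> \<in> space M \<Longrightarrow> h \<omega> = \<Phi> (history k \<omega>)"
    using adapted_factor[OF h] by blast
  let ?X = "\<lambda>\<omega>. of_bool ({I k \<omega>, J k \<omega>} = {i, j}) :: real" and ?Y = "\<lambda>\<omega>. \<Phi> (history k \<omega>)"
  have "indep_var (PiM {k} (\<lambda>_. count_space UNIV)) (\<lambda>\<omega>. \<lambda>k\<in>{k}. {I k \<omega>, J k \<omega>})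
      (PiM {..<k} (\<lambda>_. count_space UNIV)) (history k)"
    unfolding history_def by (rule indep_var_restrict[OF edges_indep]) auto
  then have "indep_var borel ((\<lambda>s. of_bool (s k = {i, j}) :: real) \<circ> (\<lambda>\<omega>. \<lambda>k\<in>{k}. {I k \<omega>, J k \<omega>}))
      borel (\<Phi> \<circ> history k)"
    by (rule indep_var_compose) (simp_all add: PiM_count_space_subsets)
  then have indep: "indep_var borel ?X borel ?Y"
    by (simp add: comp_def)
  have intY: "integrable M ?Y"
    using integrable_adapted[OF h] by (simp add: \<Phi> cong: Bochner_Integration.integrable_cong)
  have intX: "integrable M ?X"
    by (rule integrable_adapted[of "Suc k"]) (auto simp: adapted_def dest: history_eqD[where k = k])
  have X: "expectation ?X = p i j"
  proof -
    have "expectation ?X = expectation (indicator {\<omega> \<in> space M. {I k \<omega>, J k \<omega>} = {i, j}})"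
      by (intro Bochner_Integration.integral_cong) (auto simp: indicator_def)
    then show ?thesis
      using edges_law[OF e] by (simp add: Int_def cong: conj_cong)
  qed
  have Y: "expectation ?Y = expectation h"
    by (intro Bochner_Integration.integral_cong) (auto simp: \<Phi>)
  have cong: "expectation (\<lambda>\<omega>. ?X \<omega> * h \<omega>) = expectation (\<lambda>\<omega>. ?X \<omega> * ?Y \<omega>)"
    by (intro Bochner_Integration.integral_cong) (auto simp: \<Phi>)
  show "expectation (\<lambda>\<omega>. ?X \<omega> * h \<omega>) = p i j * expectation h"
    unfolding cong indep_var_lebesgue_integral[OF indep intX intY] X Y ..
  have "integrable M (\<lambda>\<omega>. ?X \<omega> * h \<omega>) = integrable M (\<lambda>\<omega>. ?X \<omega> * ?Y \<omega>)"
    by (intro Bochner_Integration.integrable_cong) (auto simp: \<Phi>)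
  then show "integrable M (\<lambda>\<omega>. ?X \<omega> * h \<omega>)"
    using indep_var_integrable[OF indep intX intY] by simp
qed

text \<open>Evaluation at a random edge becomes a finite sum of indicators. An edge matches in both
  orientations, hence the factor 1/2.\<close>

lemma sum_edge_choice:
  assumes "H a b = H b a"
  shows "(1 / 2) * (\<Sum>(i, j)\<in>E. of_bool ({a, b} = {i, j}) * H i j) = of_bool ((a, b) \<in> E) * (H a b :: real)"
proof (cases "(a, b) \<in> E")
  case True
  then have E: "(b, a) \<in> E" "a \<noteq> b"
    using E_sym edge_neq by (auto dest: symD)
  have "(\<Sum>(i, j)\<in>E. of_bool ({a, b} = {i, j}) * H i j) = (\<Sum>(i, j)\<in>{(a, b), (b, a)}. H i j)"
    using True E by (intro sum.mono_neutral_cong_right) (auto simp: doubleton_eq_iff)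
  then show ?thesis
    using True E assms by simp
next
  case False
  then have "(\<Sum>(i, j)\<in>E. of_bool ({a, b} = {i, j}) * H i j) = 0"
    using E_sym by (intro sum.neutral) (auto simp: doubleton_eq_iff dest: symD)
  with False show ?thesis by simp
qed

text \<open>The law is prescribed on edges only, but there it already has total mass 1, so any other
  pair has probability 0.\<close>

lemma AE_edge: "AE \<omega> in M. \<forall>k. (I k \<omega>, J k \<omega>) \<in> E"
  unfolding AE_all_countable
proof
  fix k
  let ?h = "\<lambda>\<omega>. of_bool ((I k \<omega>, J k \<omega>) \<in> E) :: real"
  have h: "?h \<omega> = (1 / 2) * (\<Sum>(i, j)\<in>E. of_bool ({I k \<omega>, J k \<omega>} = {i, j}) * 1)" for \<omega>
    using sum_edge_choice[of "\<lambda>_ _. 1" "I k \<omega>" "J k \<omega>"] by simp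
  have ad: "adapted k (\<lambda>_. 1 :: real)"
    by (simp add: adapted_def)
  have int: "integrable M ?h"
    unfolding h case_prod_unfold
    by (intro integrable_mult_right Bochner_Integration.integrable_sum expectation_at_edge(2)[OF ad]) auto
  have "expectation ?h = (1 / 2) * (\<Sum>(i, j)\<in>E. p i j)"
    unfolding h case_prod_unfold integral_mult_right_zero
    by (subst Bochner_Integration.integral_sum) (auto simp: expectation_at_edge[OF ad, simplified] prob_space intro!: sum.cong)
  then have "expectation (\<lambda>\<omega>. 1 - ?h \<omega>) = 0"
    using int by (simp add: p_sum prob_space)
  then have "AE \<omega> in M. 1 - ?h \<omega> = 0"
    using int by (subst (asm) integral_nonneg_eq_0_iff_AE) auto
  then show "AE \<omega> in M. (I k \<omega>, J k \<omega>) \<in> E"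
    by eventually_elim (auto split: if_splits)
qed

lemma expectation_edge:
  fixes H :: "'v \<Rightarrow> 'v \<Rightarrow> 'w \<Rightarrow> real"
  assumes ad: "\<And>i j. adapted k (H i j)" and sym: "\<And>i j \<omega>. H i j \<omega> = H j i \<omega>"
    and h: "integrable M (\<lambda>\<omega>. H (I k \<omega>) (J k \<omega>) \<omega>)"
  shows "expectation (\<lambda>\<omega>. H (I k \<omega>) (J k \<omega>) \<omega>) = (1 / 2) * (\<Sum>(i, j)\<in>E. p i j * expectation (H i j))"
proof -
  let ?S = "\<lambda>\<omega>. (1 / 2) * (\<Sum>(i, j)\<in>E. of_bool ({I k \<omega>, J k \<omega>} = {i, j}) * H i j \<omega>)"
  have int: "integrable M ?S"
    unfolding case_prod_unfold
    by (intro integrable_mult_right Bochner_Integration.integrable_sum expectation_at_edge(2)[OF ad]) auto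
  have "expectation (\<lambda>\<omega>. H (I k \<omega>) (J k \<omega>) \<omega>) = expectation ?S"
  proof (rule integral_cong_AE)
    show "AE \<omega> in M. H (I k \<omega>) (J k \<omega>) \<omega> = ?S \<omega>"
      using AE_edge
    proof eventually_elim
      case (elim \<omega>)
      then show ?case
        using sum_edge_choice[of "\<lambda>i j. H i j \<omega>" "I k \<omega>" "J k \<omega>"] sym by simp
    qed
  qed (rule borel_measurable_integrable[OF h] borel_measurable_integrable[OF int])+
  also have "\<dots> = (1 / 2) * (\<Sum>(i, j)\<in>E. p i j * expectation (H i j))"
    unfolding case_prod_unfold integral_mult_right_zero
    by (subst Bochner_Integration.integral_sum) (auto simp: expectation_at_edge[OF ad] intro!: sum.cong)
  finally show ?thesis .
qed

section \<open>Expected decrease\<close>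

definition expected_sqstep :: "nat \<Rightarrow> real" where
  "expected_sqstep k = expectation (\<lambda>\<omega>. (norm (x (Suc k) \<omega> - x k \<omega>))\<^sup>2)"

definition sqgrad :: "nat \<Rightarrow> 'w \<Rightarrow> real" where
  "sqgrad k \<omega> = edge_form (g (x (D k) \<omega>)) (g (x (D k) \<omega>))"

lemma AE_run: "AE \<omega> in M. delayed_run E p L f g D \<tau> \<alpha> (\<lambda>k. x k \<omega>) (\<lambda>k. I k \<omega>) (\<lambda>k. J k \<omega>)"
  using AE_edge AE_space
proof eventually_elim
  case (elim \<omega>)
  show ?case
    by unfold_locales (use elim delay_le delay_bound \<alpha>_pos in \<open>auto simp: x_step pair_update_eq\<close>)
qed

lemma integrable_value: "integrable M (\<lambda>\<omega>. F (x n \<omega>) :: real)"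
  by (rule integrable_adapted[of n]) (auto intro: adapted_iterates)

lemma integrable_sqstep: "integrable M (\<lambda>\<omega>. (norm (x (Suc k) \<omega> - x k \<omega>))\<^sup>2)"
  by (rule integrable_adapted[of "Suc k"]) (auto intro: adapted_iterates)

lemma integrable_sqgrad: "integrable M (sqgrad k)"
  unfolding sqgrad_def by (rule integrable_value)

lemma expected_sqstep_nonneg: "0 \<le> expected_sqstep k"
  unfolding expected_sqstep_def by simp

text \<open>The gradient read at \<open>D k\<close> is determined before edge \<open>k\<close> is
  drawn. Averaging its squared projections over that edge gives \<open>edge_form\<close>.\<close>

lemma expected_sqstep_eq: "expected_sqstep k = (\<alpha> / L)\<^sup>2 * expectation (sqgrad k)"
proof -
  let ?H = "\<lambda>i j \<omega>. (\<alpha> / L)\<^sup>2 * (norm (pair_proj i j (g (x (D k) \<omega>))))\<^sup>2"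
  have H: "(norm (x (Suc k) \<omega> - x k \<omega>))\<^sup>2 = ?H (I k \<omega>) (J k \<omega>) \<omega>" if "\<omega> \<in> space M" for \<omega>
    using that by (simp add: x_step pair_update_eq power_mult_distrib power_divide)
  have "expected_sqstep k = expectation (\<lambda>\<omega>. ?H (I k \<omega>) (J k \<omega>) \<omega>)"
    unfolding expected_sqstep_def by (intro Bochner_Integration.integral_cong refl H)
  also have "\<dots> = (1 / 2) * (\<Sum>(i, j)\<in>E. p i j * expectation (?H i j))"
  proof (rule expectation_edge)
    show "integrable M (\<lambda>\<omega>. ?H (I k \<omega>) (J k \<omega>) \<omega>)"
      using integrable_sqstep[of k] by (simp add: H cong: Bochner_Integration.integrable_cong)
    show "adapted k (?H i j)" for i j
      using delay_le[of k] by (intro adapted_iterates) auto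
  qed (simp add: pair_proj_commute)
  also have "\<dots> = expectation (\<lambda>\<omega>. (1 / 2) * (\<Sum>(i, j)\<in>E. p i j * ?H i j \<omega>))"
    unfolding case_prod_unfold
    by (subst integral_mult_right_zero, subst Bochner_Integration.integral_sum) (auto intro!: integrable_value[of _ "D k"])
  also have "\<dots> = expectation (\<lambda>\<omega>. (\<alpha> / L)\<^sup>2 * sqgrad k \<omega>)"
    unfolding sqgrad_def edge_form_norm
    by (simp add: sum_distrib_left case_prod_unfold mult_ac)
  finally show ?thesis
    by simp
qed

text \<open>The change between consecutive read points is bounded by the steps in between. By strong
  induction these are in turn bounded by geometric multiples of step \<open>k\<close>.\<close>

lemma expected_sqstep_growth:
  assumes \<rho>: "\<rho> > 1" and \<alpha>: "\<alpha> * (real \<tau> + 1) * (1 + \<rho> ^ \<tau>) * \<rho> \<le> \<rho> - 1"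
  shows "expected_sqstep k \<le> \<rho> * expected_sqstep (Suc k)"
proof (induction k rule: less_induct)
  case (less k)
  have geom: "expected_sqstep m \<le> \<rho> ^ (k - m) * expected_sqstep k" if "m \<le> k" for m
    using that
  proof (induction m rule: inc_induct)
    case (step m)
    have "expected_sqstep m \<le> \<rho> * expected_sqstep (Suc m)"
      using step by (intro less) auto
    also have "\<dots> \<le> \<rho> * (\<rho> ^ (k - Suc m) * expected_sqstep k)"
      using step \<rho> by (intro mult_left_mono) auto
    also have "\<dots> = \<rho> ^ (k - m) * expected_sqstep k"
      using step by (simp add: Suc_diff_Suc flip: power_Suc mult.assoc)
    finally show ?case .
  qed simp
  \<comment> \<open>The steps separating the two read points. Index \<open>k\<close> itself can
    occur, since \<open>D (Suc k)\<close> may be \<open>Suc k\<close>; hence up to \<tau> + 1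
    indices.\<close>
  let ?T = "{min (D k) (D (Suc k))..<max (D k) (D (Suc k))}"
  have T: "?T \<subseteq> {k - \<tau>..k}"
    using delay_le[of k] delay_le[of "Suc k"] delay_bound[of k] delay_bound[of "Suc k"] by auto
  have cardT: "card ?T \<le> \<tau> + 1"
    using card_mono[OF _ T] by simp
  have "AE \<omega> in M. (\<alpha> / L)\<^sup>2 * (sqgrad k \<omega> - sqgrad (Suc k) \<omega>)
      \<le> \<alpha> * (\<Sum>t\<in>?T. (\<alpha> / L)\<^sup>2 * sqgrad k \<omega> + (norm (x (Suc t) \<omega> - x t \<omega>))\<^sup>2)"
    using AE_run
  proof eventually_elim
    case (elim \<omega>)
    then show ?case
      using delayed_run.edge_form_variation[OF elim, of "D k" "D (Suc k)"]
      by (simp add: sqgrad_def delayed_run.stepsize_def[OF elim])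
  qed
  then have "expectation (\<lambda>\<omega>. (\<alpha> / L)\<^sup>2 * (sqgrad k \<omega> - sqgrad (Suc k) \<omega>))
      \<le> expectation (\<lambda>\<omega>. \<alpha> * (\<Sum>t\<in>?T. (\<alpha> / L)\<^sup>2 * sqgrad k \<omega> + (norm (x (Suc t) \<omega> - x t \<omega>))\<^sup>2))"
    by (intro integral_mono_AE integrable_mult_right Bochner_Integration.integrable_sum Bochner_Integration.integrable_diff
        Bochner_Integration.integrable_add integrable_sqgrad integrable_sqstep)
  also have "expectation (\<lambda>\<omega>. (\<alpha> / L)\<^sup>2 * (sqgrad k \<omega> - sqgrad (Suc k) \<omega>))
      = expected_sqstep k - expected_sqstep (Suc k)"
    by (simp add: expected_sqstep_eq integrable_sqgrad right_diff_distrib)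
  also have "expectation (\<lambda>\<omega>. \<alpha> * (\<Sum>t\<in>?T. (\<alpha> / L)\<^sup>2 * sqgrad k \<omega> + (norm (x (Suc t) \<omega> - x t \<omega>))\<^sup>2))
      = \<alpha> * (\<Sum>t\<in>?T. expected_sqstep k + expected_sqstep t)"
    unfolding integral_mult_right_zero
    by (simp add: expected_sqstep_eq[of k] integrable_sqgrad integrable_sqstep
        flip: expected_sqstep_def del: sum_constant)
  also have "\<dots> \<le> \<alpha> * (\<Sum>t\<in>?T. (1 + \<rho> ^ \<tau>) * expected_sqstep k)"
  proof (intro mult_left_mono sum_mono)
    fix t assume "t \<in> ?T"
    with T have "t \<in> {k - \<tau>..k}" by blast
    then have t: "t \<le> k" "k - t \<le> \<tau>" by auto
    have "expected_sqstep t \<le> \<rho> ^ (k - t) * expected_sqstep k"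
      by (rule geom[OF t(1)])
    also have "\<dots> \<le> \<rho> ^ \<tau> * expected_sqstep k"
      using \<rho> t expected_sqstep_nonneg by (intro mult_right_mono power_increasing) auto
    finally show "expected_sqstep k + expected_sqstep t \<le> (1 + \<rho> ^ \<tau>) * expected_sqstep k"
      by (simp add: distrib_right)
  qed (use \<alpha>_pos in simp)
  also have "\<dots> = real (card ?T) * (\<alpha> * (1 + \<rho> ^ \<tau>) * expected_sqstep k)"
    by (simp only: sum_constant mult_ac)
  also have "\<dots> \<le> (real \<tau> + 1) * (\<alpha> * (1 + \<rho> ^ \<tau>) * expected_sqstep k)"
    using cardT \<alpha>_pos \<rho> expected_sqstep_nonneg[of k] by (intro mult_right_mono mult_nonneg_nonneg) auto
  \<comment> \<open>Multiplication by \<rho> brings the right side into the form of the hypothesis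
    on \<alpha>; cancelling \<open>\<rho> * expected_sqstep k\<close> then leaves the claim.\<close>
  finally have "\<rho> * (expected_sqstep k - expected_sqstep (Suc k))
      \<le> \<rho> * ((real \<tau> + 1) * (\<alpha> * (1 + \<rho> ^ \<tau>) * expected_sqstep k))"
    using \<rho> by (intro mult_left_mono) auto
  also have "\<dots> \<le> (\<rho> - 1) * expected_sqstep k"
    using mult_right_mono[OF \<alpha> expected_sqstep_nonneg[of k]] by (simp add: mult_ac)
  finally show ?case
    by (simp add: algebra_simps)
qed

lemma expected_sqstep_geometric:
  assumes "\<rho> > 1" "\<alpha> * (real \<tau> + 1) * (1 + \<rho> ^ \<tau>) * \<rho> \<le> \<rho> - 1" "k - \<tau> \<le> t" "t \<le> k"
  shows "expected_sqstep t \<le> \<rho> ^ \<tau> * expected_sqstep k"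
proof -
  have "expected_sqstep t \<le> \<rho> ^ (k - t) * expected_sqstep k"
    using \<open>t \<le> k\<close>
  proof (induction k rule: dec_induct)
    case (step k)
    have "expected_sqstep t \<le> \<rho> ^ (k - t) * expected_sqstep k"
      by (rule step.IH)
    also have "\<dots> \<le> \<rho> ^ (k - t) * (\<rho> * expected_sqstep (Suc k))"
      using expected_sqstep_growth[OF assms(1,2)] assms(1) by (intro mult_left_mono) auto
    finally show ?case
      using step by (simp add: Suc_diff_le mult_ac)
  qed simp
  also have "\<dots> \<le> \<rho> ^ \<tau> * expected_sqstep k"
    using assms expected_sqstep_nonneg by (intro mult_right_mono power_increasing) auto
  finally show ?thesis .
qed

text \<open>In expectation the past steps in \<open>step_descent\<close> cost at most \<tau>
  \<rho>^\<tau> times the current squared step, which the descent term absorbs.\<close>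

lemma expected_descent:
  assumes "\<rho> > 1" "\<alpha> * (real \<tau> + 1) * (1 + \<rho> ^ \<tau>) * \<rho> \<le> \<rho> - 1"
  shows "expectation (\<lambda>\<omega>. f (x (Suc k) \<omega>)) \<le> expectation (\<lambda>\<omega>. f (x k \<omega>))
     - \<alpha>\<^sup>2 * (1 / \<alpha> - (1 + real \<tau> + real \<tau> * \<rho> ^ \<tau>) / 2) * expectation (\<lambda>\<omega>. sqgrad k \<omega> / L)"
proof -
  let ?s = "\<lambda>t \<omega>. (norm (x (Suc t) \<omega> - x t \<omega>))\<^sup>2" and ?c = "L * (1 / \<alpha> - (1 + real \<tau>) / 2)"
  have "AE \<omega> in M. f (x (Suc k) \<omega>) \<le> f (x k \<omega>) - ?c * ?s k \<omega> + L / 2 * (\<Sum>t\<in>{k - \<tau>..<k}. ?s t \<omega>)"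
    using AE_run
  proof eventually_elim
    case (elim \<omega>)
    then show ?case
      using delayed_run.step_descent[OF elim, of k] by (simp add: delayed_run.stepsize_def[OF elim])
  qed
  then have "expectation (\<lambda>\<omega>. f (x (Suc k) \<omega>))
      \<le> expectation (\<lambda>\<omega>. f (x k \<omega>) - ?c * ?s k \<omega> + L / 2 * (\<Sum>t\<in>{k - \<tau>..<k}. ?s t \<omega>))"
    by (intro integral_mono_AE integrable_mult_right Bochner_Integration.integrable_sum Bochner_Integration.integrable_diff
        Bochner_Integration.integrable_add integrable_value integrable_sqstep)
  also have "\<dots> = expectation (\<lambda>\<omega>. f (x k \<omega>)) - ?c * expected_sqstep k
      + L / 2 * (\<Sum>t\<in>{k - \<tau>..<k}. expected_sqstep t)"
    by (simp add: integrable_value integrable_sqstep expected_sqstep_def)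
  also have "\<dots> \<le> expectation (\<lambda>\<omega>. f (x k \<omega>)) - ?c * expected_sqstep k
      + L / 2 * (real \<tau> * (\<rho> ^ \<tau> * expected_sqstep k))"
  proof (intro add_left_mono mult_left_mono)
    have "(\<Sum>t\<in>{k - \<tau>..<k}. expected_sqstep t) \<le> (\<Sum>t\<in>{k - \<tau>..<k}. \<rho> ^ \<tau> * expected_sqstep k)"
      by (intro sum_mono expected_sqstep_geometric[OF assms]) auto
    also have "\<dots> = real (card {k - \<tau>..<k}) * (\<rho> ^ \<tau> * expected_sqstep k)"
      by (simp only: sum_constant)
    also have "\<dots> \<le> real \<tau> * (\<rho> ^ \<tau> * expected_sqstep k)"
      using assms(1) expected_sqstep_nonneg by (intro mult_right_mono mult_nonneg_nonneg) auto
    finally show "(\<Sum>t\<in>{k - \<tau>..<k}. expected_sqstep t) \<le> real \<tau> * (\<rho> ^ \<tau> * expected_sqstep k)" .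
  qed (use L_pos in simp)
  also have "\<dots> = expectation (\<lambda>\<omega>. f (x k \<omega>))
      - L * (1 / \<alpha> - (1 + real \<tau> + real \<tau> * \<rho> ^ \<tau>) / 2) * expected_sqstep k"
    by (simp add: algebra_simps add_divide_distrib)
  also have "expected_sqstep k = \<alpha>\<^sup>2 / L * expectation (\<lambda>\<omega>. sqgrad k \<omega> / L)"
    by (simp add: expected_sqstep_eq power2_eq_square)
  finally show ?thesis
    using L_pos by (simp add: mult_ac)
qed

text \<open>Jensen's inequality for the square, read off from the nonnegative variance.\<close>

lemma expectation_squared_le:
  assumes "integrable M h" "integrable M (\<lambda>\<omega>. (h \<omega>)\<^sup>2 :: real)"
  shows "(expectation h)\<^sup>2 \<le> expectation (\<lambda>\<omega>. (h \<omega>)\<^sup>2)"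
  using variance_positive[of h] variance_eq[OF assms] by simp

end

section \<open>The convergence rate\<close>

text \<open>A division-free form of the usual argument with 1/\<delta>, so that \<delta> may vanish.
  With a = c \<delta>(k), the recursion gives r c \<delta>(k+1) \<le> a(r - a). If a \<le> r, the
  induction hypothesis bounds (k+1)a(r - a) by (r + a)(r - a) \<le> r^2; otherwise the left side is
  nonpositive.\<close>

lemma sublinear_rate:
  fixes \<delta> :: "nat \<Rightarrow> real"
  assumes dec: "\<And>k. \<delta> (Suc k) \<le> \<delta> k - c * q k" and q: "\<And>k. (\<delta> k)\<^sup>2 \<le> r * q k"
    and nonneg: "\<And>k. 0 \<le> \<delta> k" and c: "0 \<le> c" and r: "0 \<le> r"
  shows "c * real k * \<delta> k \<le> r"
proof (cases "r = 0")
  case True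
  with q[of k] show ?thesis by simp
next
  case False
  show ?thesis
  proof (induction k)
    case (Suc k)
    let ?a = "c * \<delta> k"
    have "c * (r * \<delta> (Suc k)) \<le> c * (r * \<delta> k - c * (r * q k))"
      using mult_left_mono[OF dec r, of k] c by (intro mult_left_mono) (simp_all add: algebra_simps)
    also have "\<dots> \<le> c * (r * \<delta> k - c * (\<delta> k)\<^sup>2)"
      using q[of k] c by (intro mult_left_mono diff_left_mono) auto
    also have "\<dots> = ?a * (r - ?a)"
      by (simp add: power2_eq_square algebra_simps)
    finally have step: "c * (r * \<delta> (Suc k)) \<le> ?a * (r - ?a)" .
    have "r * (c * real (Suc k) * \<delta> (Suc k)) = (real k + 1) * (c * (r * \<delta> (Suc k)))"
      by (simp add: algebra_simps)
    also have "\<dots> \<le> (real k + 1) * (?a * (r - ?a))"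
      using step by (intro mult_left_mono) auto
    also have "\<dots> \<le> r * r"
    proof (cases "?a \<le> r")
      case True
      have "(real k + 1) * (?a * (r - ?a)) = (c * real k * \<delta> k + ?a) * (r - ?a)"
        by (simp add: algebra_simps)
      also have "\<dots> \<le> (r + ?a) * (r - ?a)"
        using True Suc by (intro mult_right_mono) auto
      also have "\<dots> \<le> r * r"
        using zero_le_square[of ?a] by (simp add: algebra_simps)
      finally show ?thesis .
    next
      case False
      then have "?a * (r - ?a) \<le> 0"
        using c nonneg by (intro mult_nonneg_nonpos) auto
      then have "(real k + 1) * (?a * (r - ?a)) \<le> 0"
        by (rule mult_nonneg_nonpos[rotated]) simp
      then show ?thesis
        by (rule order_trans) simp
    qed
    finally show ?case
      using False r by simp
  qed (use r in simp)
qed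

lemma le_maximum: "has_maximum S \<Longrightarrow> s \<in> S \<Longrightarrow> s \<le> maximum S"
  unfolding has_maximum_def maximum_def by (metis Greatest_equality)

lemma dual_norm_le_radius:
  assumes "u \<in> sublevel f x0" "xs \<in> optimal_set f"
    and "has_maximum (distances_to_opt f L p u)" "has_maximum (max_distances f L p x0)"
  shows "dual_norm_K L p (u - xs) \<le> radius f L p x0"
proof -
  have "dual_norm_K L p (u - xs) \<le> maximum (distances_to_opt f L p u)"
    by (rule le_maximum[OF assms(3)]) (use assms(2) in \<open>auto simp: distances_to_opt_def\<close>)
  also have "\<dots> \<le> radius f L p x0"
    unfolding radius_def
    by (rule le_maximum[OF assms(4)]) (use assms(1) in \<open>auto simp: max_distances_def\<close>)
  finally show ?thesis .
qed

lemma optimal_value_eq: "xs \<in> optimal_set f \<Longrightarrow> optimal_value f = f xs"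
  unfolding optimal_value_def optimal_set_def by (intro cInf_eq_minimum) auto

text \<open>Follows from \<tau> + 1 \<le> sqrt 2 (\<tau> + 2) and (1 + \<rho>^\<tau>)\<rho> =
  \<rho>^(\<tau>+1) + \<rho>.\<close>

lemma growth_condition:
  fixes \<rho> \<alpha> :: real and \<tau> :: nat
  assumes \<rho>: "\<rho> > 1" and \<alpha>: "\<alpha> > 0" "\<alpha> < (\<rho> - 1) / (sqrt 2 * (real \<tau> + 2) * (\<rho> ^ (\<tau> + 1) + \<rho>))"
  shows "\<alpha> * (real \<tau> + 1) * (1 + \<rho> ^ \<tau>) * \<rho> \<le> \<rho> - 1"
proof -
  have pos: "0 < \<rho> ^ (\<tau> + 1) + \<rho>"
    using \<rho> by (intro add_pos_pos zero_less_power) auto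
  have "\<alpha> * (real \<tau> + 1) * (1 + \<rho> ^ \<tau>) * \<rho> = \<alpha> * (1 * (real \<tau> + 1) * (\<rho> ^ (\<tau> + 1) + \<rho>))"
    by (simp add: algebra_simps)
  also have "\<dots> \<le> \<alpha> * (sqrt 2 * (real \<tau> + 2) * (\<rho> ^ (\<tau> + 1) + \<rho>))"
    using \<alpha>(1) pos by (intro mult_left_mono mult_right_mono mult_mono) auto
  also have "\<dots> \<le> \<rho> - 1"
    using \<alpha>(2) pos by (simp add: pos_less_divide_eq less_imp_le)
  finally show ?thesis .
qed

theorem theorem4:
  fixes f :: "('y::{real_inner, heine_borel}, 'z::{real_inner, heine_borel}, 'v::finite) point \<Rightarrow> real"
    and g :: "('y, 'z, 'v) point \<Rightarrow> ('y, 'z, 'v) point"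
    and L :: real
    and E :: "('v \<times> 'v) set"
    and p :: "'v \<Rightarrow> 'v \<Rightarrow> real"
    and M :: "'w measure"
    and I J :: "nat \<Rightarrow> 'w \<Rightarrow> 'v"
    and D :: "nat \<Rightarrow> nat"
    and \<tau> :: nat
    and \<rho> \<alpha> \<mu> :: real
    and x0 :: "('y, 'z, 'v) point"
    and x :: "nat \<Rightarrow> 'w \<Rightarrow> ('y, 'z, 'v) point"
  assumes f_convex: "convex_on UNIV f"
    and f_grad: "\<And>u. GDERIV f u :> g u"
    and grad_cont: "continuous_on UNIV g"
    and opt_nonempty: "optimal_set f \<noteq> {}"
    and L_pos: "L > 0"
    and lipschitz_block:
      "\<And>i u h. norm (g (u + axis i h) $ i - g u $ i) \<le> L * norm h"
    and lipschitz_edge: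
      "\<And>i j u h h'. (i, j) \<in> E \<Longrightarrow>
         norm ((g (u + axis i h + axis j h') $ i, g (u + axis i h + axis j h') $ j) - (g u $ i, g u $ j))
           \<le> L * norm (h, h')"
    and E_sym: "sym E"
    and E_irrefl: "irrefl E"
    and E_connected: "\<And>i j. (i, j) \<in> E\<^sup>*"
    and p_sym: "\<And>i j. p i j = p j i"
    and p_edge: "\<And>i j. (i, j) \<in> E \<Longrightarrow> p i j > 0"
    and p_nonedge: "\<And>i j. (i, j) \<notin> E \<Longrightarrow> p i j = 0"
    and p_sum: "(\<Sum>(i, j)\<in>E. p i j) = 2"
    and prob: "prob_space M"
    and edges_indep:
      "prob_space.indep_vars M (\<lambda>_. count_space UNIV) (\<lambda>k \<omega>. {I k \<omega>, J k \<omega>}) UNIV"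
    and edges_law:
      "\<And>k i j. (i, j) \<in> E \<Longrightarrow> measure M {\<omega> \<in> space M. {I k \<omega>, J k \<omega>} = {i, j}} = p i j"
    and delay_le: "\<And>k. D k \<le> k"
    and delay_bound: "\<And>k. k - D k \<le> \<tau>"
    and x0_feasible: "x0 \<in> feasible"
    and x_init: "\<And>\<omega>. \<omega> \<in> space M \<Longrightarrow> x 0 \<omega> = x0"
    and x_step: "\<And>k \<omega>. \<omega> \<in> space M \<Longrightarrow>
      x (Suc k) \<omega> = pair_update L \<alpha> (g (x (D k) \<omega>)) (I k \<omega>) (J k \<omega>) (x k \<omega>)"
    and inner_max: "\<And>u. u \<in> sublevel f x0 \<Longrightarrow> has_maximum (distances_to_opt f L p u)"
    and outer_max: "has_maximum (max_distances f L p x0)"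
    and \<rho>_gt: "\<rho> > 1"
    and \<alpha>_pos: "\<alpha> > 0"
    and \<alpha>_bound1: "\<alpha> < 2 / (1 + real \<tau> + real \<tau> * \<rho> ^ \<tau>)"
    and \<alpha>_bound2: "\<alpha> < (\<rho> - 1) / (sqrt 2 * (real \<tau> + 2) * (\<rho> ^ (\<tau> + 1) + \<rho>))"
    and \<mu>_def: "\<mu> = \<alpha>\<^sup>2 / 2 * (1 / \<alpha> - (1 + real \<tau> + real \<tau> * \<rho> ^ \<tau>) / 2)"
  shows "\<forall>k\<ge>1. prob_space.expectation M (\<lambda>\<omega>. f (x k \<omega>)) - optimal_value f
           \<le> (radius f L p x0)\<^sup>2 / (\<mu> * real k)"
proof (intro allI impI)
  fix n :: nat
  assume "1 \<le> n"
  interpret random_run E p L f g M D \<tau> \<alpha> I J x0 x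
    by (intro random_run.intro smooth_problem.intro edge_graph.intro smooth_problem_axioms.intro
        random_run_axioms.intro assms)
  obtain xs where xs: "xs \<in> optimal_set f"
    using opt_nonempty by blast
  define B where "B = 1 + real \<tau> + real \<tau> * \<rho> ^ \<tau>"
  have "1 \<le> \<rho> ^ \<tau>"
    using \<rho>_gt by (intro one_le_power) simp
  then have "real \<tau> * 1 \<le> real \<tau> * \<rho> ^ \<tau>"
    by (intro mult_left_mono) auto
  \<comment> \<open>Thus the first step size bound also implies the condition of
    \<open>run_in_sublevel\<close>.\<close>
  then have B: "1 + 2 * real \<tau> \<le> B"
    by (simp add: B_def)
  have \<alpha>B: "\<alpha> * B < 2"
    using \<alpha>_bound1 B by (simp add: B_def[symmetric] pos_less_divide_eq)
  have "\<alpha> * (1 + 2 * real \<tau>) \<le> \<alpha> * B"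
    using B \<alpha>_pos by (intro mult_left_mono) auto
  with \<alpha>B have \<alpha>\<tau>: "\<alpha> * (1 + 2 * real \<tau>) \<le> 2"
    by simp
  have "\<mu> = \<alpha> / 4 * (2 - \<alpha> * B)"
    using \<alpha>_pos by (simp add: \<mu>_def B_def field_simps power2_eq_square)
  moreover have "0 < \<alpha> / 4 * (2 - \<alpha> * B)"
    using \<alpha>B \<alpha>_pos by simp
  ultimately have \<mu>: "0 < \<mu>"
    by (simp only:)
  have growth: "\<alpha> * (real \<tau> + 1) * (1 + \<rho> ^ \<tau>) * \<rho> \<le> \<rho> - 1"
    by (rule growth_condition[OF \<rho>_gt \<alpha>_pos \<alpha>_bound2])
  define R where "R = radius f L p x0"
  \<comment> \<open>Membership in the sublevel set holds almost surely, not only in expectation;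
    this lets \<open>R\<close> bound every distance that occurs.\<close>
  have feasible_run: "AE \<omega> in M. \<forall>k. x k \<omega> \<in> feasible \<and> f (x k \<omega>) \<le> f x0"
    using AE_run AE_space
  proof eventually_elim
    case (elim \<omega>)
    then show ?case
      using delayed_run.run_in_sublevel[OF elim(1) \<alpha>\<tau>] delayed_run.run_feasible[OF elim(1)] x0_feasible
      by (simp add: x_init)
  qed
  have gap: "0 \<le> f u - f xs" if "u \<in> feasible" for u
    using xs that by (simp add: optimal_set_def)
  have gap_bound: "f u - f xs \<le> sqrt (edge_form (g u) (g u) / L) * R" if "u \<in> feasible" "f u \<le> f x0" for u
  proof -
    have "dual_norm_K L p (u - xs) \<le> R"
      unfolding R_def using that xs inner_max[of u] outer_max
      by (intro dual_norm_le_radius) (auto simp: sublevel_def)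
    then show ?thesis
      using gap_le[OF that(1) xs] edge_form_nonneg L_pos
      by (meson mult_left_mono order_trans real_sqrt_ge_zero divide_nonneg_pos)
  qed
  define \<delta> where "\<delta> k = expectation (\<lambda>\<omega>. f (x k \<omega>)) - f xs" for k
  define q where "q k = expectation (\<lambda>\<omega>. sqgrad k \<omega> / L)" for k
  have \<delta>_eq: "\<delta> k = expectation (\<lambda>\<omega>. f (x k \<omega>) - f xs)" for k
    by (simp add: \<delta>_def integrable_value prob_space)
  have \<delta>_nonneg: "0 \<le> \<delta> k" for k
    unfolding \<delta>_eq using feasible_run gap by (intro integral_nonneg_AE) (auto elim: eventually_mono)
  have q_nonneg: "0 \<le> q k" for k
    unfolding q_def using L_pos by (intro Bochner_Integration.integral_nonneg) (auto simp: sqgrad_def edge_form_nonneg)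
  have dec: "\<delta> (Suc k) \<le> \<delta> k - 2 * \<mu> * q k" for k
    using expected_descent[OF \<rho>_gt growth, of k] by (simp add: \<delta>_def q_def \<mu>_def)
  \<comment> \<open>\<open>q k\<close> involves the gradient at the stale point, so the gap
    inequality controls \<open>\<delta> (D k)\<close>; monotonicity transfers the bound to
    \<open>\<delta> k\<close>.\<close>
  have "decseq \<delta>"
    using dec q_nonneg \<mu> by (intro decseq_SucI) (smt (verit) mult_nonneg_nonneg)
  then have \<delta>_delay: "\<delta> k \<le> \<delta> (D k)" for k
    using delay_le[of k] by (simp add: decseq_def)
  have sq: "(\<delta> k)\<^sup>2 \<le> R\<^sup>2 * q k" for k
  proof -
    let ?G = "\<lambda>\<omega>. sqrt (sqgrad k \<omega> / L)"
    have G2: "(?G \<omega>)\<^sup>2 = sqgrad k \<omega> / L" for \<omega>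
      using L_pos by (simp add: sqgrad_def edge_form_nonneg)
    have intG: "integrable M ?G"
      unfolding sqgrad_def by (rule integrable_value)
    have "\<delta> (D k) \<le> expectation (\<lambda>\<omega>. ?G \<omega> * R)"
      unfolding \<delta>_eq
    proof (rule integral_mono_AE)
      show "AE \<omega> in M. f (x (D k) \<omega>) - f xs \<le> ?G \<omega> * R"
        using feasible_run by eventually_elim (simp add: sqgrad_def gap_bound)
    qed (use intG in \<open>auto intro!: integrable_value[of "\<lambda>u. f u - f xs"]\<close>)
    then have "\<delta> k \<le> expectation ?G * R"
      using \<delta>_delay[of k] by simp
    then have "(\<delta> k)\<^sup>2 \<le> (expectation ?G * R)\<^sup>2"
      using \<delta>_nonneg by (rule power_mono)
    also have "\<dots> = R\<^sup>2 * (expectation ?G)\<^sup>2"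
      by (simp add: power_mult_distrib)
    also have "\<dots> \<le> R\<^sup>2 * q k"
      using expectation_squared_le[OF intG] integrable_sqgrad
      by (intro mult_left_mono) (simp_all add: G2 q_def)
    finally show ?thesis .
  qed
  \<comment> \<open>The decrease has coefficient \<open>2 * \<mu>\<close>; the factor 2 is dropped
    afterwards because the product is nonnegative.\<close>
  have "2 * \<mu> * real n * \<delta> n \<le> R\<^sup>2"
    using \<mu> by (intro sublinear_rate[where q = q] dec sq \<delta>_nonneg) auto
  moreover have "0 \<le> \<mu> * real n * \<delta> n"
    using \<mu> \<delta>_nonneg by simp
  ultimately have "\<delta> n * (\<mu> * real n) \<le> R\<^sup>2"
    by (simp add: mult_ac)
  then have "\<delta> n \<le> R\<^sup>2 / (\<mu> * real n)"
    using \<mu> \<open>1 \<le> n\<close> by (simp add: pos_le_divide_eq)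
  then show "expectation (\<lambda>\<omega>. f (x n \<omega>)) - optimal_value f \<le> (radius f L p x0)\<^sup>2 / (\<mu> * real n)"
    by (simp add: \<delta>_def R_def optimal_value_eq[OF xs])
qed

end
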